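(* Let $m=(m_{n_1,n_2}:n_1,n_2\in\mathbb{N}_0)$ be a sequence of measurable functions on $\mathbb{R}^2$ satisfying, for some constant $B$, $$\sup_{\xi\in\mathbb{R}^2}\sum_{n_1,n_2\in\mathbb{N}}\big|\Delta_{n_1,n_2}(m)(\xi)\big|\le B,$$ $$\sup_{\xi\in\mathbb{R}^2}\sum_{n_1\in\mathbb{N}}\big|\Delta^1_{n_1,0}(m)(\xi)\big|\le B,\qquad \sup_{\xi\in\mathbb{R}^2}\sum_{n_2\in\mathbb{N}}\big|\Delta^2_{0,n_2}(m)(\xi)\big|\le B,$$ $$\sup_{\xi\in\mathbb{R}^2}|m_{0,0}(\xi)|\le B.$$ Then there is a constant $C>0$ such that for all integers $N_1,N_2\ge 2$ and all $f\in L^2(\mathbb{R}^2)$, $$\Big\|\sup_{0\le n_1<N_1}\ \sup_{0\le n_2<N_2}\big|\mathcal{F}^{-1}\big(m_{n_1,n_2}\mathcal{F}f\big)\big|\Big\|_{L^2}\le C\,B\,(\log N_1)(\log N_2)\,\|f\|_{L^2}.$$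
   Context: $\mathbb{N}=\{1,2,\dots\}$ and $\mathbb{N}_0=\mathbb{N}\cup\{0\}$. For a two-parameter sequence $a=(a_{n_1,n_2}:n_1,n_2\in\mathbb{N}_0)$ the difference operators are $$\Delta^1_{n_1,n_2}(a)=a_{n_1,n_2}-a_{n_1-1,n_2},\qquad \Delta^2_{n_1,n_2}(a)=a_{n_1,n_2}-a_{n_1,n_2-1},$$ $$\Delta_{n_1,n_2}(a)=a_{n_1,n_2}-a_{n_1,n_2-1}-a_{n_1-1,n_2}+a_{n_1-1,n_2-1},$$ whenever the indices involved are nonnegative; for sequences of functions they are applied pointwise. $\mathcal{F}$ is the Fourier transform on $\mathbb{R}^2$, $\mathcal{F}f(\xi)=\int_{\mathbb{R}^2}e^{-2\pi i\xi\cdot x}f(x)\,dx$ (extended to $L^2$), and $\mathcal{F}^{-1}$ is its inverse. *)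

theory Defs
  imports "HOL-Analysis.Analysis"
begin

text \<open>
  Elements of \<open>L\<^sup>2\<close> are represented by functions rather than by almost-everywhere classes.
  The norm \<open>L2_norm f\<close> is meaningful only for \<open>f \<in> L2\<close>: the Bochner integral of a
  non-integrable function is \<open>0\<close>.
\<close>

definition L2 :: "('a::euclidean_space \<Rightarrow> 'b::real_normed_vector) set" where
  "L2 = {f \<in> borel_measurable lebesgue. integrable lebesgue (\<lambda>x. (norm (f x))\<^sup>2)}"

definition L2_norm :: "('a::euclidean_space \<Rightarrow> 'b::real_normed_vector) \<Rightarrow> real" where
  "L2_norm f = sqrt (LINT x|lebesgue. (norm (f x))\<^sup>2)"

definition L2_tendsto ::
    "(nat \<Rightarrow> 'a::euclidean_space \<Rightarrow> 'b::real_normed_vector) \<Rightarrow> ('a \<Rightarrow> 'b) \<Rightarrow> bool" where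
  "L2_tendsto u f \<longleftrightarrow>
     (\<forall>k. u k \<in> L2) \<and> f \<in> L2 \<and> (\<lambda>k. L2_norm (\<lambda>x. u k x - f x)) \<longlonglongrightarrow> 0"

definition fourier :: "('a::euclidean_space \<Rightarrow> complex) \<Rightarrow> 'a \<Rightarrow> complex" where
  "fourier f \<xi> = (LINT x|lebesgue. exp (- 2 * of_real pi * \<i> * of_real (\<xi> \<bullet> x)) * f x)"

text \<open>
  The extension by continuity of the Fourier integral from \<open>L\<^sup>1 \<inter> L\<^sup>2\<close> to \<open>L\<^sup>2\<close>, and the
  inverse of the resulting bijection of \<open>L\<^sup>2\<close>. Both values are determined only up to
  null sets, so a representative is chosen.
\<close>

definition fourier_L2 :: "('a::euclidean_space \<Rightarrow> complex) \<Rightarrow> 'a \<Rightarrow> complex" where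
  "fourier_L2 f = (SOME g. \<exists>u. (\<forall>k. integrable lebesgue (u k)) \<and> L2_tendsto u f \<and>
                               L2_tendsto (\<lambda>k. fourier (u k)) g)"

definition inv_fourier_L2 :: "('a::euclidean_space \<Rightarrow> complex) \<Rightarrow> 'a \<Rightarrow> complex" where
  "inv_fourier_L2 g = (SOME f. f \<in> L2 \<and> (AE \<xi> in lebesgue. fourier_L2 f \<xi> = g \<xi>))"

text \<open>
  Since subtraction on \<^typ>\<open>nat\<close> truncates, the difference operators have their intended
  meaning only when every index that is decremented is positive.
\<close>

definition diff1 :: "(nat \<Rightarrow> nat \<Rightarrow> 'a::ab_group_add) \<Rightarrow> nat \<Rightarrow> nat \<Rightarrow> 'a" where
  "diff1 a n1 n2 = a n1 n2 - a (n1 - 1) n2"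

definition diff2 :: "(nat \<Rightarrow> nat \<Rightarrow> 'a::ab_group_add) \<Rightarrow> nat \<Rightarrow> nat \<Rightarrow> 'a" where
  "diff2 a n1 n2 = a n1 n2 - a n1 (n2 - 1)"

definition diff12 :: "(nat \<Rightarrow> nat \<Rightarrow> 'a::ab_group_add) \<Rightarrow> nat \<Rightarrow> nat \<Rightarrow> 'a" where
  "diff12 a n1 n2 = a n1 n2 - a n1 (n2 - 1) - a (n1 - 1) n2 + a (n1 - 1) (n2 - 1)"

end

theory Submission
  imports Defs "HOL-Probability.Characteristic_Functions"
begin

text \<open>
  Put \<open>b j1 j2\<close> for the mixed difference of \<open>m\<close>, where \<open>m\<close> is extended by \<open>0\<close> to negative indices, so
  that \<open>m n1 n2\<close> is the sum of \<open>b\<close> over \<open>{..n1} \<times> {..n2}\<close> and the hypotheses say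
  \<open>\<Sum> \<bar>b j1 j2\<bar> \<le> 4 B\<close> pointwise. As in the Rademacher--Menshov argument, binary expansion splits
  the rectangle into dyadic blocks, at most one for each pair of scales, so the maximal function is
  at most the sum, over about \<open>log N1 * log N2\<close> pairs of scales, of the square functions of all blocks
  of that pair of scales. By Plancherel each square function has norm at most \<open>4 B \<parallel>f\<parallel>\<close>, because the
  blocks are disjoint and an \<open>\<ell>\<^sup>2\<close> sum is at most the \<open>\<ell>\<^sup>1\<close> sum.
\<close>

section \<open>The space \<open>L\<^sup>2\<close>\<close>

text \<open>\<open>fourier_L2\<close> and \<open>inv_fourier_L2\<close> are arbitrary choices of
  representatives, so nothing is known about them until existence, uniqueness and surjectivity of
  the transform have been proved. The graph relation \<open>is_fourier_L2\<close> carries these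
  facts: it is linear and isometric, and each side determines the other up to null sets. An identity
  between multipliers thus becomes an almost-everywhere identity between functions; as only
  countably many index pairs occur, one null set serves them all and the combinatorics takes place
  at a single point x.

  The obstacle is that the indices attaining the maximum depend on x, so Plancherel cannot be
  applied to the maximal function itself. A sum over all pairs of scales, with all blocks of a pair
  collected in an l2 norm, is a majorant free of these indices. In the place of orthogonality of the
  blocks stands the pointwise bound on the multipliers, which controls the l2 norm of all block
  multipliers at each frequency. The factor 4 counts the corner, the two edges and the interior of
  the index quadrant.\<close>

lemma L2_measurable: "f \<in> L2 \<Longrightarrow> f \<in> borel_measurable lebesgue"
  by (simp add: L2_def)

lemma L2_integrable: "f \<in> L2 \<Longrightarrow> integrable lebesgue (\<lambda>x. (norm (f x))\<^sup>2)"
  by (simp add: L2_def)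

lemma L2_I:
  "f \<in> borel_measurable lebesgue \<Longrightarrow> integrable lebesgue (\<lambda>x. (norm (f x))\<^sup>2) \<Longrightarrow> f \<in> L2"
  by (simp add: L2_def)

lemma L2_norm_nonneg [simp]: "0 \<le> L2_norm f"
  by (simp add: L2_norm_def)

lemma L2_norm_square: "(L2_norm f)\<^sup>2 = (LINT x|lebesgue. (norm (f x))\<^sup>2)"
  by (simp add: L2_norm_def)

lemma L2_dominated:
  fixes f :: "'a::euclidean_space \<Rightarrow> 'b::euclidean_space" and g :: "'a \<Rightarrow> 'c::euclidean_space"
  assumes f: "f \<in> borel_measurable lebesgue" and g: "g \<in> L2"
    and le: "AE x in lebesgue. norm (f x) \<le> c * norm (g x)" and "0 \<le> c"
  shows "f \<in> L2" "L2_norm f \<le> c * L2_norm g"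
proof -
  note [measurable] = f
  have le2: "AE x in lebesgue. (norm (f x))\<^sup>2 \<le> c\<^sup>2 * (norm (g x))\<^sup>2"
    using le by eventually_elim (metis norm_ge_zero power_mono power_mult_distrib)
  have int: "integrable lebesgue (\<lambda>x. c\<^sup>2 * (norm (g x))\<^sup>2)"
    using L2_integrable[OF g] by simp
  have "integrable lebesgue (\<lambda>x. (norm (f x))\<^sup>2)"
    by (rule Bochner_Integration.integrable_bound[OF int]) (use le2 in \<open>auto\<close>)
  then show "f \<in> L2" using f by (simp add: L2_I)
  have "(L2_norm f)\<^sup>2 \<le> (c * L2_norm g)\<^sup>2"
    unfolding power_mult_distrib L2_norm_square
    using integral_mono_AE[OF L2_integrable[OF \<open>f \<in> L2\<close>] int le2] by simp
  then show "L2_norm f \<le> c * L2_norm g"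
    using \<open>0 \<le> c\<close> by (simp add: power2_le_iff_abs_le)
qed

lemma L2_norm_cong_AE:
  fixes f g :: "'a::euclidean_space \<Rightarrow> 'b::euclidean_space"
  assumes "f \<in> borel_measurable lebesgue" "g \<in> borel_measurable lebesgue" "AE x in lebesgue. f x = g x"
  shows "L2_norm f = L2_norm g"
  unfolding L2_norm_def using assms by (intro arg_cong[where f=sqrt] integral_cong_AE) auto

lemma L2_cong_AE:
  fixes f g :: "'a::euclidean_space \<Rightarrow> 'b::euclidean_space"
  assumes "f \<in> borel_measurable lebesgue" "g \<in> L2" "AE x in lebesgue. f x = g x"
  shows "f \<in> L2"
  by (rule L2_dominated(1)[OF assms(1,2), of 1]) (use assms(3) in auto)

lemma L2_norm_eq_0D:
  assumes "f \<in> L2" "L2_norm f = 0"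
  shows "AE x in lebesgue. f x = 0"
proof -
  have "(LINT x|lebesgue. (norm (f x))\<^sup>2) = 0"
    using assms(2) by (simp add: L2_norm_square[symmetric])
  then have "AE x in lebesgue. (norm (f x))\<^sup>2 = 0"
    using integral_nonneg_eq_0_iff_AE[OF L2_integrable[OF assms(1)]] by simp
  then show ?thesis by simp
qed

lemma L2_mult_integrable:
  fixes f :: "'a::euclidean_space \<Rightarrow> 'b::euclidean_space" and g :: "'a \<Rightarrow> 'c::euclidean_space"
  assumes f: "f \<in> L2" and g: "g \<in> L2"
  shows "integrable lebesgue (\<lambda>x. norm (f x) * norm (g x))"
proof (rule Bochner_Integration.integrable_bound)
  show "integrable lebesgue (\<lambda>x. (norm (f x))\<^sup>2 + (norm (g x))\<^sup>2)"
    using f g by (simp add: L2_integrable)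
  show "(\<lambda>x. norm (f x) * norm (g x)) \<in> borel_measurable lebesgue"
    using L2_measurable[OF f] L2_measurable[OF g] by measurable
  have "norm (f x) * norm (g x) \<le> (norm (f x))\<^sup>2 + (norm (g x))\<^sup>2" for x
    using sum_squares_bound[of "norm (f x)" "norm (g x)"]
      mult_nonneg_nonneg[OF norm_ge_zero[of "f x"] norm_ge_zero[of "g x"]]
    by linarith
  then show "AE x in lebesgue. norm (norm (f x) * norm (g x)) \<le> norm ((norm (f x))\<^sup>2 + (norm (g x))\<^sup>2)"
    by auto
qed

lemma L2_Cauchy_Schwarz:
  fixes f :: "'a::euclidean_space \<Rightarrow> 'b::euclidean_space" and g :: "'a \<Rightarrow> 'c::euclidean_space"
  assumes f: "f \<in> L2" and g: "g \<in> L2"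
  shows "(LINT x|lebesgue. norm (f x) * norm (g x)) \<le> L2_norm f * L2_norm g"
proof -
  note [measurable] = L2_measurable[OF f] L2_measurable[OF g]
  have "(\<integral>\<^sup>+x. ennreal (norm (f x)) * ennreal (norm (g x)) \<partial>lebesgue)\<^sup>2
      \<le> (\<integral>\<^sup>+x. (ennreal (norm (f x)))\<^sup>2 \<partial>lebesgue) * (\<integral>\<^sup>+x. (ennreal (norm (g x)))\<^sup>2 \<partial>lebesgue)"
    by (rule Cauchy_Schwarz_nn_integral) auto
  also have "(\<integral>\<^sup>+x. ennreal (norm (f x)) * ennreal (norm (g x)) \<partial>lebesgue) =
      ennreal (LINT x|lebesgue. norm (f x) * norm (g x))"
    by (simp add: ennreal_mult[symmetric] nn_integral_eq_integral[OF L2_mult_integrable[OF f g]])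
  also have "(\<integral>\<^sup>+x. (ennreal (norm (f x)))\<^sup>2 \<partial>lebesgue) = ennreal ((L2_norm f)\<^sup>2)"
    by (simp add: ennreal_power L2_norm_square nn_integral_eq_integral[OF L2_integrable[OF f]])
  also have "(\<integral>\<^sup>+x. (ennreal (norm (g x)))\<^sup>2 \<partial>lebesgue) = ennreal ((L2_norm g)\<^sup>2)"
    by (simp add: ennreal_power L2_norm_square nn_integral_eq_integral[OF L2_integrable[OF g]])
  finally have "(LINT x|lebesgue. norm (f x) * norm (g x))\<^sup>2 \<le> (L2_norm f * L2_norm g)\<^sup>2"
    by (simp add: ennreal_power ennreal_mult[symmetric] power_mult_distrib)
  then show ?thesis by (simp add: power2_le_iff_abs_le)
qed

lemma
  fixes f g :: "'a::euclidean_space \<Rightarrow> 'b::euclidean_space"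
  assumes f: "f \<in> L2" and g: "g \<in> L2"
  shows L2_add: "(\<lambda>x. f x + g x) \<in> L2"
    and L2_norm_triangle: "L2_norm (\<lambda>x. f x + g x) \<le> L2_norm f + L2_norm g"
proof -
  note [measurable] = L2_measurable[OF f] L2_measurable[OF g]
  let ?h = "\<lambda>x. (norm (f x))\<^sup>2 + 2 * (norm (f x) * norm (g x)) + (norm (g x))\<^sup>2"
  have int: "integrable lebesgue ?h"
    using L2_integrable[OF f] L2_integrable[OF g] L2_mult_integrable[OF f g] by simp
  have le: "(norm (f x + g x))\<^sup>2 \<le> ?h x" for x
  proof -
    have "(norm (f x + g x))\<^sup>2 \<le> (norm (f x) + norm (g x))\<^sup>2"
      by (intro power_mono norm_triangle_ineq) auto
    then show ?thesis by (simp add: power2_sum)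
  qed
  have int2: "integrable lebesgue (\<lambda>x. (norm (f x + g x))\<^sup>2)"
    by (rule Bochner_Integration.integrable_bound[OF int])
      (use order_trans[OF le abs_ge_self] in \<open>simp_all\<close>)
  then show "(\<lambda>x. f x + g x) \<in> L2" by (intro L2_I) measurable
  have "(L2_norm (\<lambda>x. f x + g x))\<^sup>2 \<le> integral\<^sup>L lebesgue ?h"
    unfolding L2_norm_square by (rule integral_mono[OF int2 int le])
  also have "\<dots> = (L2_norm f)\<^sup>2 + 2 * (LINT x|lebesgue. norm (f x) * norm (g x)) + (L2_norm g)\<^sup>2"
    using L2_integrable[OF f] L2_integrable[OF g] L2_mult_integrable[OF f g]
    by (simp add: L2_norm_square)
  also have "\<dots> \<le> (L2_norm f + L2_norm g)\<^sup>2"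
    using L2_Cauchy_Schwarz[OF f g] by (simp add: power2_sum)
  finally show "L2_norm (\<lambda>x. f x + g x) \<le> L2_norm f + L2_norm g"
    by (simp add: power2_le_iff_abs_le)
qed

lemma L2_zero [simp]: "(\<lambda>x. 0) \<in> L2"
  by (simp add: L2_def)

lemma L2_norm_zero [simp]: "L2_norm (\<lambda>x. 0) = 0"
  by (simp add: L2_norm_def)

lemma L2_uminus: "f \<in> L2 \<Longrightarrow> (\<lambda>x. - f x) \<in> L2" for f :: "'a::euclidean_space \<Rightarrow> 'b::euclidean_space"
  by (auto simp add: L2_def)

lemma L2_norm_uminus [simp]: "L2_norm (\<lambda>x. - f x) = L2_norm f"
  by (simp add: L2_norm_def)

lemma L2_norm_minus_commute: "L2_norm (\<lambda>x. f x - g x) = L2_norm (\<lambda>x. g x - f x)"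
  by (simp add: L2_norm_def norm_minus_commute)

lemma
  fixes f g :: "'a::euclidean_space \<Rightarrow> 'b::euclidean_space"
  assumes f: "f \<in> L2" and g: "g \<in> L2"
  shows L2_diff: "(\<lambda>x. f x - g x) \<in> L2"
    and L2_norm_diff: "L2_norm (\<lambda>x. f x - g x) \<le> L2_norm f + L2_norm g"
  using L2_add[OF f L2_uminus[OF g]] L2_norm_triangle[OF f L2_uminus[OF g]] by simp_all

lemma L2_norm_triangle_diff:
  fixes f g h :: "'a::euclidean_space \<Rightarrow> 'b::euclidean_space"
  assumes "f \<in> L2" "g \<in> L2" "h \<in> L2"
  shows "L2_norm (\<lambda>x. f x - h x) \<le> L2_norm (\<lambda>x. f x - g x) + L2_norm (\<lambda>x. g x - h x)"
  using L2_norm_triangle[OF L2_diff[OF assms(1,2)] L2_diff[OF assms(2,3)]] by simp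

lemma L2_norm_abs_diff:
  fixes f g :: "'a::euclidean_space \<Rightarrow> 'b::euclidean_space"
  assumes "f \<in> L2" "g \<in> L2"
  shows "\<bar>L2_norm f - L2_norm g\<bar> \<le> L2_norm (\<lambda>x. f x - g x)"
  using L2_norm_triangle[OF L2_diff[OF assms] assms(2)]
    L2_norm_triangle[OF L2_diff[OF assms(2,1)] assms(1)]
  by (simp add: L2_norm_minus_commute[of f g])

lemma
  fixes f :: "'i \<Rightarrow> 'a::euclidean_space \<Rightarrow> 'b::euclidean_space"
  assumes "\<And>i. i \<in> I \<Longrightarrow> f i \<in> L2"
  shows L2_sum: "(\<lambda>x. \<Sum>i\<in>I. f i x) \<in> L2"
    and L2_norm_sum: "L2_norm (\<lambda>x. \<Sum>i\<in>I. f i x) \<le> (\<Sum>i\<in>I. L2_norm (f i))"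
proof -
  have "(\<lambda>x. \<Sum>i\<in>I. f i x) \<in> L2 \<and> L2_norm (\<lambda>x. \<Sum>i\<in>I. f i x) \<le> (\<Sum>i\<in>I. L2_norm (f i))"
    using assms
  proof (induction I rule: infinite_finite_induct)
    case (insert i I)
    then have IH: "(\<lambda>x. \<Sum>i\<in>I. f i x) \<in> L2" "L2_norm (\<lambda>x. \<Sum>i\<in>I. f i x) \<le> (\<Sum>i\<in>I. L2_norm (f i))"
      and "f i \<in> L2" by auto
    then show ?case
      using insert.hyps L2_add[OF \<open>f i \<in> L2\<close> IH(1)] L2_norm_triangle[OF \<open>f i \<in> L2\<close> IH(1)] by simp
  qed auto
  then show "(\<lambda>x. \<Sum>i\<in>I. f i x) \<in> L2" "L2_norm (\<lambda>x. \<Sum>i\<in>I. f i x) \<le> (\<Sum>i\<in>I. L2_norm (f i))"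
    by auto
qed

section \<open>Convergence in the \<open>L2\<close> norm\<close>

lemma L2_tendstoD:
  assumes "L2_tendsto u f"
  shows "u k \<in> L2" "f \<in> L2" "(\<lambda>k. L2_norm (\<lambda>x. u k x - f x)) \<longlonglongrightarrow> 0"
  using assms by (auto simp: L2_tendsto_def)

lemma L2_tendsto_norm:
  fixes f :: "'a::euclidean_space \<Rightarrow> 'b::euclidean_space"
  assumes "L2_tendsto u f"
  shows "(\<lambda>k. L2_norm (u k)) \<longlonglongrightarrow> L2_norm f"
proof (rule LIM_zero_cancel, rule Lim_null_comparison)
  show "(\<lambda>k. L2_norm (\<lambda>x. u k x - f x)) \<longlonglongrightarrow> 0" by (rule L2_tendstoD[OF assms])
  show "\<forall>\<^sub>F k in sequentially. norm (L2_norm (u k) - L2_norm f) \<le> L2_norm (\<lambda>x. u k x - f x)"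
    using L2_norm_abs_diff L2_tendstoD(1,2)[OF assms] by (intro always_eventually allI) auto
qed

lemma L2_tendsto_diff:
  fixes f :: "'a::euclidean_space \<Rightarrow> 'b::euclidean_space"
  assumes u: "L2_tendsto u f" and v: "L2_tendsto v g"
  shows "L2_tendsto (\<lambda>k x. u k x - v k x) (\<lambda>x. f x - g x)"
proof -
  note l = L2_tendstoD(1,2)[OF u] L2_tendstoD(1,2)[OF v]
  have eq: "u k x - v k x - (f x - g x) = (u k x - f x) - (v k x - g x)" for k x
    by simp
  have "(\<lambda>k. L2_norm (\<lambda>x. u k x - v k x - (f x - g x))) \<longlonglongrightarrow> 0"
  proof (rule Lim_null_comparison)
    show "(\<lambda>k. L2_norm (\<lambda>x. u k x - f x) + L2_norm (\<lambda>x. v k x - g x)) \<longlonglongrightarrow> 0"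
      using tendsto_add[OF L2_tendstoD(3)[OF u] L2_tendstoD(3)[OF v]] by simp
    have "L2_norm (\<lambda>x. (u k x - f x) - (v k x - g x))
        \<le> L2_norm (\<lambda>x. u k x - f x) + L2_norm (\<lambda>x. v k x - g x)" for k
      by (rule L2_norm_diff[OF L2_diff[OF l(1,2)] L2_diff[OF l(3,4)]])
    then show "\<forall>\<^sub>F k in sequentially. norm (L2_norm (\<lambda>x. u k x - v k x - (f x - g x)))
        \<le> L2_norm (\<lambda>x. u k x - f x) + L2_norm (\<lambda>x. v k x - g x)"
      unfolding eq by simp
  qed
  then show ?thesis
    unfolding L2_tendsto_def using L2_diff[OF l(1,3)] L2_diff[OF l(2,4)] by blast
qed

section \<open>Completeness and density\<close>

text \<open>Serves wherever only pointwise convergence is at hand: for the limit in the completeness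
  proof and for Fourier integrals of approximants. Membership in \<open>L2\<close> is a conclusion,
  hence the passage through nonnegative integrals.\<close>

lemma L2_Fatou:
  fixes f :: "'a::euclidean_space \<Rightarrow> 'b::euclidean_space"
  assumes v: "\<And>j. v j \<in> L2" and f: "f \<in> borel_measurable lebesgue"
    and lim: "AE x in lebesgue. (\<lambda>j. v j x) \<longlonglongrightarrow> f x"
    and le: "\<And>j. j \<ge> J \<Longrightarrow> L2_norm (v j) \<le> c"
  shows "f \<in> L2" "L2_norm f \<le> c"
proof -
  note [measurable] = L2_measurable[OF v] f
  have "0 \<le> c" using le[of J] L2_norm_nonneg[of "v J"] by linarith
  have "(\<integral>\<^sup>+x. ennreal ((norm (f x))\<^sup>2) \<partial>lebesgue)
      = (\<integral>\<^sup>+x. liminf (\<lambda>j. ennreal ((norm (v j x))\<^sup>2)) \<partial>lebesgue)"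
  proof (rule nn_integral_cong_AE, use lim in eventually_elim)
    case (elim x)
    then have "(\<lambda>j. ennreal ((norm (v j x))\<^sup>2)) \<longlonglongrightarrow> ennreal ((norm (f x))\<^sup>2)"
      by (intro tendsto_intros)
    then show ?case by (rule lim_imp_Liminf[OF trivial_limit_sequentially, symmetric])
  qed
  also have "\<dots> \<le> liminf (\<lambda>j. \<integral>\<^sup>+x. ennreal ((norm (v j x))\<^sup>2) \<partial>lebesgue)"
    by (rule nn_integral_liminf) measurable
  also have "\<dots> = liminf (\<lambda>j. ennreal ((L2_norm (v j))\<^sup>2))"
    by (simp add: L2_norm_square nn_integral_eq_integral[OF L2_integrable[OF v]])
  also have "\<dots> \<le> limsup (\<lambda>j. ennreal ((L2_norm (v j))\<^sup>2))"
    by (rule Liminf_le_Limsup) simp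
  also have "\<dots> \<le> ennreal (c\<^sup>2)"
    by (rule Limsup_bounded, rule eventually_sequentiallyI[of J]) (auto intro!: ennreal_leI power_mono le)
  finally have *: "(\<integral>\<^sup>+x. ennreal ((norm (f x))\<^sup>2) \<partial>lebesgue) \<le> ennreal (c\<^sup>2)" .
  then have int: "integrable lebesgue (\<lambda>x. (norm (f x))\<^sup>2)"
    by (intro integrableI_bounded) (auto intro: le_less_trans)
  then show "f \<in> L2" using f by (simp add: L2_I)
  have "(L2_norm f)\<^sup>2 \<le> c\<^sup>2"
    using * by (simp add: L2_norm_square nn_integral_eq_integral[OF int])
  then show "L2_norm f \<le> c" using \<open>0 \<le> c\<close> by (simp add: power2_le_iff_abs_le)
qed

text \<open>Squares of norms are integrated with the weight \<open>2^k\<close>. Against the decay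
  4^-k this leaves a convergent geometric series, so the weighted series has a finite value S almost
  everywhere. Each increment is then at most sqrt S * 2^(-k/2), which is summable.\<close>

lemma L2_fast_Cauchy_AE_convergent:
  fixes v :: "nat \<Rightarrow> 'a::euclidean_space \<Rightarrow> 'b::euclidean_space"
  assumes v: "\<And>k. v k \<in> L2" and le: "\<And>k. L2_norm (\<lambda>x. v (Suc k) x - v k x) \<le> (1/2)^k"
  shows "AE x in lebesgue. convergent (\<lambda>k. v k x)"
proof -
  define d where "d k x = v (Suc k) x - v k x" for k x
  have d: "d k \<in> L2" for k unfolding d_def[abs_def] by (intro L2_diff v)
  note [measurable] = L2_measurable[OF d]
  have dle: "(L2_norm (d k))\<^sup>2 \<le> (1/4)^k" for k
  proof -
    have "(L2_norm (d k))\<^sup>2 \<le> ((1/2)^k)\<^sup>2"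
      by (intro power_mono) (use le[of k] in \<open>simp_all add: d_def[abs_def]\<close>)
    also have "\<dots> = (1/4::real)^k" by (simp add: power_even_eq[symmetric] power_mult power2_eq_square flip: power_mult_distrib)
    finally show ?thesis .
  qed
  let ?s = "\<lambda>x. \<Sum>k. ennreal (2^k * (norm (d k x))\<^sup>2)"
  have "(\<integral>\<^sup>+x. ?s x \<partial>lebesgue) = (\<Sum>k. \<integral>\<^sup>+x. ennreal (2^k * (norm (d k x))\<^sup>2) \<partial>lebesgue)"
    by (rule nn_integral_suminf) measurable
  also have "\<dots> = (\<Sum>k. ennreal (2^k * (L2_norm (d k))\<^sup>2))"
    by (intro suminf_cong, subst nn_integral_eq_integral) (auto simp: L2_norm_square L2_integrable[OF d])
  also have "\<dots> \<le> (\<Sum>k. ennreal ((1/2)^k))"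
  proof (intro suminf_le ennreal_leI)
    fix k
    have "2^k * (L2_norm (d k))\<^sup>2 \<le> 2^k * (1/4)^k" by (intro mult_left_mono dle) auto
    also have "\<dots> = (1/2)^k" by (simp flip: power_mult_distrib)
    finally show "2^k * (L2_norm (d k))\<^sup>2 \<le> (1/2)^k" .
  qed auto
  also have "\<dots> = ennreal (\<Sum>k. (1/2)^k)"
    by (rule suminf_ennreal2) (auto intro: summable_geometric)
  finally have "(\<integral>\<^sup>+x. ?s x \<partial>lebesgue) < \<infinity>" by (simp add: le_less_trans)
  then have "AE x in lebesgue. ?s x \<noteq> \<infinity>"
    by (intro nn_integral_PInf_AE) auto
  then show ?thesis
  proof eventually_elim
    case (elim x)
    define S where "S = enn2real (?s x)"
    have "2^k * (norm (d k x))\<^sup>2 \<le> S" for k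
    proof -
      have "(\<Sum>j\<in>{k}. ennreal (2^j * (norm (d j x))\<^sup>2)) \<le> ?s x"
        by (rule sum_le_suminf) auto
      also have "?s x = ennreal S"
        unfolding S_def by (rule ennreal_enn2real[symmetric]) (use elim in \<open>simp add: less_top\<close>)
      finally have "ennreal (2^k * (norm (d k x))\<^sup>2) \<le> ennreal S"
        by (simp only: sum.insert[OF finite.emptyI] empty_iff not_False_eq_True sum.empty add_0_right)
      then show ?thesis
        by (rule ennreal_le_iff[THEN iffD1, rotated]) (simp add: S_def)
    qed
    moreover have "(sqrt S * (sqrt (1/2))^k)\<^sup>2 = S * (1/2)^k" for k
    proof -
      have "((sqrt (1/2))^k)\<^sup>2 = ((sqrt (1/2))\<^sup>2)^k" by (metis power_mult mult.commute)
      also have "\<dots> = (1/2::real)^k" by simp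
      finally show ?thesis by (simp add: power_mult_distrib S_def)
    qed
    ultimately have le: "(norm (d k x))\<^sup>2 \<le> (sqrt S * (sqrt (1/2))^k)\<^sup>2" for k
      by (simp only: power_divide power_one) (simp add: field_simps)
    have "norm (d k x) \<le> sqrt S * (sqrt (1/2))^k" for k
      by (rule power2_le_imp_le[OF le]) (simp add: S_def)
    moreover have "sqrt (1/2) < (1::real)"
      by simp
    then have "summable (\<lambda>k. sqrt S * (sqrt (1/2))^k)"
      by (intro summable_mult summable_geometric) simp
    ultimately have "summable (\<lambda>k. d k x)"
      by (rule summable_comparison_test'[rotated])
    then have "convergent (\<lambda>n. \<Sum>k<n. d k x)" by (simp add: summable_iff_convergent)
    then have "convergent (\<lambda>n. (\<Sum>k<n. d k x) + v 0 x)"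
      by (rule convergent_add) (rule convergent_const)
    then show ?case by (simp add: d_def sum_lessThan_telescope[of "\<lambda>k. v k x"])
  qed
qed

theorem L2_complete:
  fixes u :: "nat \<Rightarrow> 'a::euclidean_space \<Rightarrow> 'b::euclidean_space"
  assumes u: "\<And>k. u k \<in> L2"
    and Cauchy: "\<And>e. e > 0 \<Longrightarrow> \<exists>N. \<forall>m\<ge>N. \<forall>n\<ge>N. L2_norm (\<lambda>x. u m x - u n x) \<le> e"
  obtains f where "L2_tendsto u f"
proof -
  have "\<forall>k. \<exists>N. \<forall>m\<ge>N. \<forall>n\<ge>N. L2_norm (\<lambda>x. u m x - u n x) \<le> (1/2)^k"
    by (intro allI Cauchy) simp
  then obtain N where N: "\<And>k m n. m \<ge> N k \<Longrightarrow> n \<ge> N k \<Longrightarrow> L2_norm (\<lambda>x. u m x - u n x) \<le> (1/2)^k"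
    by metis
  \<comment> \<open>The sum dominates \<open>N k\<close> at k and at k + 1 without any monotonicity
    of \<open>N\<close>, and the summand k makes \<open>r\<close> reach every tail.\<close>
  define r where "r k = (\<Sum>i\<le>k. N i) + k" for k
  have rN: "N k \<le> r k" "N k \<le> r (Suc k)" "k \<le> r k" for k
    by (auto simp: r_def intro!: trans_le_add1 member_le_sum le_SucI)
  define v where "v k = u (r k)" for k
  define f where "f x = lim (\<lambda>k. v k x)" for x
  have vL: "v k \<in> L2" for k by (simp add: v_def u)
  note [measurable] = L2_measurable[OF u] L2_measurable[OF vL]
  have f[measurable]: "f \<in> borel_measurable lebesgue"
    unfolding f_def[abs_def] by (rule borel_measurable_lim_metric) measurable
  have "AE x in lebesgue. convergent (\<lambda>k. v k x)"
    by (rule L2_fast_Cauchy_AE_convergent) (auto simp: v_def u intro!: N rN)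
  then have lim: "AE x in lebesgue. (\<lambda>k. v k x) \<longlonglongrightarrow> f x"
    by eventually_elim (simp add: convergent_LIMSEQ_iff f_def)
  \<comment> \<open>Fatou in j for fixed n: the bound on \<open>v j - u n\<close> passes to
    \<open>f - u n\<close>. This gives convergence of the whole sequence, not just of the
    subsequence.\<close>
  have *: "(\<lambda>x. f x - u n x) \<in> L2 \<and> L2_norm (\<lambda>x. f x - u n x) \<le> e"
    if n: "\<forall>m\<ge>K. \<forall>n\<ge>K. L2_norm (\<lambda>x. u m x - u n x) \<le> e" "n \<ge> K" for e n K
  proof -
    have "AE x in lebesgue. (\<lambda>k. v k x - u n x) \<longlonglongrightarrow> f x - u n x"
      using lim by eventually_elim (intro tendsto_intros)
    moreover have "L2_norm (\<lambda>x. v j x - u n x) \<le> e" if "j \<ge> K" for j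
      unfolding v_def using n that rN(3)[of j] by auto
    moreover have "(\<lambda>x. f x - u n x) \<in> borel_measurable lebesgue"
      by measurable
    ultimately show ?thesis
      using L2_Fatou[of "\<lambda>j x. v j x - u n x" "\<lambda>x. f x - u n x" K e, OF L2_diff[OF vL u]] by blast
  qed
  obtain K where K: "\<forall>m\<ge>K. \<forall>n\<ge>K. L2_norm (\<lambda>x. u m x - u n x) \<le> 1"
    using Cauchy[of 1] by auto
  have "f \<in> L2"
    using L2_add[OF conjunct1[OF *[OF K order_refl]] u[of K]] by simp
  moreover have "(\<lambda>k. L2_norm (\<lambda>x. u k x - f x)) \<longlonglongrightarrow> 0"
  proof (rule LIMSEQ_I)
    fix e :: real assume "e > 0"
    then obtain K where K: "\<forall>m\<ge>K. \<forall>n\<ge>K. L2_norm (\<lambda>x. u m x - u n x) \<le> e/2"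
      using Cauchy[of "e/2"] by auto
    have "L2_norm (\<lambda>x. u n x - f x) < e" if "n \<ge> K" for n
      using conjunct2[OF *[OF K that]] \<open>e > 0\<close> by (simp add: L2_norm_minus_commute[of "u n"])
    then show "\<exists>no. \<forall>n\<ge>no. norm (L2_norm (\<lambda>x. u n x - f x) - 0) < e"
      by auto
  qed
  ultimately have "L2_tendsto u f"
    unfolding L2_tendsto_def using u by blast
  then show ?thesis by (rule that)
qed

section \<open>Density of the continuous functions of compact support\<close>

definition Cc :: "('a::euclidean_space \<Rightarrow> 'b::euclidean_space) set" where
  "Cc = {f. continuous_on UNIV f \<and> (\<exists>R. \<forall>x. R < norm x \<longrightarrow> f x = 0)}"

lemma Cc_bounded:
  assumes "f \<in> Cc" obtains M where "0 \<le> M" "\<And>x. norm (f x) \<le> M"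
proof -
  obtain R where R: "\<And>x. R < norm x \<Longrightarrow> f x = 0" and c: "continuous_on UNIV f"
    using assms by (auto simp: Cc_def)
  have "compact (f ` cball 0 R)"
    by (intro compact_continuous_image continuous_on_subset[OF c]) auto
  then have "bounded (f ` cball 0 R)" by (rule compact_imp_bounded)
  then obtain M where M: "\<forall>x\<in>cball 0 R. norm (f x) \<le> M"
    unfolding bounded_iff by blast
  have "norm (f x) \<le> max M 0" for x
    using M R[of x] by (cases "norm x \<le> R") (auto intro: max.coboundedI1)
  then show ?thesis by (intro that[of "max M 0"]) auto
qed

lemma Cc_borel_measurable: "f \<in> Cc \<Longrightarrow> f \<in> borel_measurable borel"
  by (auto simp: Cc_def intro: borel_measurable_continuous_onI)

lemma Cc_integrable_lborel:
  assumes "f \<in> Cc" shows "integrable lborel f"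
proof -
  obtain R where R: "\<And>x. R < norm x \<Longrightarrow> f x = 0" and c: "continuous_on UNIV f"
    using assms by (auto simp: Cc_def)
  have "integrable lborel (\<lambda>x. indicator (cball 0 R) x *\<^sub>R f x)"
    by (intro borel_integrable_compact continuous_on_subset[OF c]) auto
  also have "(\<lambda>x. indicator (cball 0 R) x *\<^sub>R f x) = f"
    using R by (auto simp: indicator_def fun_eq_iff not_le)
  finally show ?thesis .
qed

lemma Cc_integrable:
  assumes "f \<in> Cc" shows "integrable lebesgue f"
  using Cc_integrable_lborel[OF assms] Cc_borel_measurable[OF assms] by (simp add: integrable_completion)

lemma Cc_L2:
  assumes "f \<in> Cc" shows "f \<in> L2"
proof -
  have *: "(\<lambda>x. (norm (f x))\<^sup>2) \<in> Cc"
    using assms by (auto simp: Cc_def intro!: continuous_intros)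
  show ?thesis
    using Cc_integrable[OF *] borel_measurable_integrable[OF Cc_integrable[OF assms]]
    by (intro L2_I)
qed

text \<open>Lebesgue measurability supplies continuous functions converging to \<open>f\<close> off
  a negligible set, but without any bound or support condition. Clipping their values and cutting
  them off in space adds both and keeps the limit, after which dominated convergence
  applies.\<close>

lemma Cc_approx_bounded:
  fixes f :: "'a::euclidean_space \<Rightarrow> 'b::euclidean_space"
  assumes f[measurable]: "f \<in> borel_measurable lebesgue" and "R > 0"
    and bd: "\<And>x. norm (f x) \<le> R" and supp: "\<And>x. R < norm x \<Longrightarrow> f x = 0" and "e > 0"
  shows "\<exists>u\<in>Cc. L2_norm (\<lambda>x. u x - f x) < e \<and> (LINT x|lebesgue. norm (u x - f x)) < e"
proof -
  obtain N g where N: "negligible N" and g: "\<And>n. continuous_on UNIV (g n)"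
    and lim: "\<And>x. x \<notin> N \<Longrightarrow> (\<lambda>n. g n x) \<longlonglongrightarrow> f x"
    using lebesgue_measurable_imp_measurable_on[of f UNIV] by (auto simp: measurable_on_def)
  \<comment> \<open>\<open>clip\<close> is the retraction onto the ball of radius \<open>R\<close>,
    which contains all values of \<open>f\<close>; the cutoff \<open>\<theta>\<close> is 1 on the
    ball of radius \<open>R\<close> and 0 outside radius \<open>R + 1\<close>.\<close>
  define clip where "clip y = (R / max R (norm y)) *\<^sub>R y" for y :: 'b
  define \<theta> where "\<theta> x = max 0 (min 1 (R + 1 - norm x))" for x :: 'a
  define u where "u n x = \<theta> x *\<^sub>R clip (g n x)" for n x
  have cont_clip: "continuous_on UNIV clip"
    unfolding clip_def[abs_def] using \<open>R > 0\<close> by (intro continuous_intros) auto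
  have clip_le: "norm (clip y) \<le> R" for y
    using \<open>R > 0\<close> by (auto simp: clip_def field_simps max_def)
  have clip_eq: "clip y = y" if "norm y \<le> R" for y
    using \<open>R > 0\<close> that by (simp add: clip_def max_def)
  have u_Cc: "u n \<in> Cc" for n
    unfolding Cc_def
  proof (intro CollectI conjI exI[of _ "R+1"] allI impI)
    have "continuous_on UNIV (\<lambda>x. clip (g n x))"
      by (rule continuous_on_compose2[OF cont_clip g]) auto
    then show "continuous_on UNIV (u n)"
      unfolding u_def[abs_def] \<theta>_def by (intro continuous_intros)
  qed (auto simp: u_def \<theta>_def)
  note [measurable] = L2_measurable[OF Cc_L2[OF u_Cc]]
  have ulim: "AE x in lebesgue. (\<lambda>n. u n x - f x) \<longlonglongrightarrow> 0"
  proof -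
    have "(\<lambda>n. u n x) \<longlonglongrightarrow> f x" if "x \<notin> N" for x
    proof -
      have "(\<lambda>n. clip (g n x)) \<longlonglongrightarrow> clip (f x)"
        using continuous_on_tendsto_compose[OF cont_clip lim[OF that]] by auto
      then have "(\<lambda>n. u n x) \<longlonglongrightarrow> \<theta> x *\<^sub>R clip (f x)"
        unfolding u_def by (intro tendsto_intros)
      also have "\<theta> x *\<^sub>R clip (f x) = f x"
        using clip_eq[OF bd] supp[of x] by (cases "norm x \<le> R") (auto simp: \<theta>_def clip_def)
      finally show ?thesis .
    qed
    then have "(\<lambda>n. u n x - f x) \<longlonglongrightarrow> 0" if "x \<notin> N" for x
      using that LIM_zero by blast
    then show ?thesis
      using N by (auto simp: negligible_iff_null_sets intro: AE_I')
  qed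
  have ule: "norm (u n x - f x) \<le> 2 * R * indicator (cball 0 (R+1)) x" for n x
  proof (cases "norm x \<le> R + 1")
    case True
    have "norm (u n x) \<le> 1 * R"
      unfolding u_def norm_scaleR by (intro mult_mono clip_le) (use \<open>R > 0\<close> in \<open>auto simp: \<theta>_def\<close>)
    then have "norm (u n x - f x) \<le> R + R"
      using bd[of x] norm_triangle_ineq4[of "u n x" "f x"] by linarith
    with True show ?thesis by simp
  next
    case False
    then show ?thesis using supp[of x] by (simp add: u_def \<theta>_def)
  qed
  have fin: "emeasure lebesgue (cball 0 (R+1) :: 'a set) < \<infinity>"
    using emeasure_bounded_finite[of "cball 0 (R+1) :: 'a set"] by simp
  have "(\<lambda>n. LINT x|lebesgue. norm (u n x - f x)) \<longlonglongrightarrow> (LINT x|(lebesgue :: 'a measure). 0)"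
  proof (rule integral_dominated_convergence[where w="\<lambda>x. 2 * R * indicator (cball 0 (R+1)) x"])
    show "AE x in lebesgue. (\<lambda>n. norm (u n x - f x)) \<longlonglongrightarrow> 0"
      using ulim by eventually_elim (rule tendsto_norm_zero)
  qed (use ule fin in auto)
  then have *: "(\<lambda>n. LINT x|lebesgue. norm (u n x - f x)) \<longlonglongrightarrow> 0" by simp
  have "(\<lambda>n. LINT x|lebesgue. (norm (u n x - f x))\<^sup>2) \<longlonglongrightarrow> (LINT x|(lebesgue :: 'a measure). 0)"
  proof (rule integral_dominated_convergence[where w="\<lambda>x. (2 * R)\<^sup>2 * indicator (cball 0 (R+1)) x"])
    show "AE x in lebesgue. (\<lambda>n. (norm (u n x - f x))\<^sup>2) \<longlonglongrightarrow> 0"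
      using ulim by eventually_elim (auto intro: tendsto_eq_intros)
    have "(norm (u n x - f x))\<^sup>2 \<le> (2 * R * indicator (cball 0 (R+1)) x)\<^sup>2" for n x
      by (intro power_mono ule) auto
    moreover have "(2 * R * indicator (cball 0 (R+1)) x)\<^sup>2 = (2 * R)\<^sup>2 * indicator (cball 0 (R+1)) x" for x :: 'a
      by (simp add: indicator_def)
    ultimately have "(norm (u n x - f x))\<^sup>2 \<le> (2 * R)\<^sup>2 * indicator (cball 0 (R+1)) x" for n x
      by metis
    then show "AE x in lebesgue. norm ((norm (u n x - f x))\<^sup>2) \<le> (2 * R)\<^sup>2 * indicator (cball 0 (R+1)) x" for n
      by auto
  qed (use fin in auto)
  then have "(\<lambda>n. L2_norm (\<lambda>x. u n x - f x)) \<longlonglongrightarrow> 0"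
    unfolding L2_norm_def by (auto intro: tendsto_eq_intros)
  then have "\<forall>\<^sub>F n in sequentially. L2_norm (\<lambda>x. u n x - f x) < e"
    using \<open>e > 0\<close> by (rule order_tendstoD)
  moreover have "\<forall>\<^sub>F n in sequentially. (LINT x|lebesgue. norm (u n x - f x)) < e"
    using * \<open>e > 0\<close> by (rule order_tendstoD)
  ultimately have "\<forall>\<^sub>F n in sequentially. L2_norm (\<lambda>x. u n x - f x) < e \<and> (LINT x|lebesgue. norm (u n x - f x)) < e"
    by eventually_elim simp
  then obtain n where "L2_norm (\<lambda>x. u n x - f x) < e \<and> (LINT x|lebesgue. norm (u n x - f x)) < e"
    using eventually_happens' trivial_limit_sequentially by blast
  then show ?thesis using u_Cc by auto
qed

lemma Cc_approx:
  fixes f :: "'a::euclidean_space \<Rightarrow> 'b::euclidean_space"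
  assumes f: "f \<in> L2" and "e > 0"
  shows "\<exists>u\<in>Cc. L2_norm (\<lambda>x. u x - f x) < e \<and>
           (integrable lebesgue f \<longrightarrow> (LINT x|lebesgue. norm (u x - f x)) < e)"
proof -
  note [measurable] = L2_measurable[OF f]
  \<comment> \<open>Truncation in space and in value by the same k, so that
    \<open>Cc_approx_bounded\<close> applies with \<open>R = k\<close>; it asks for k > 0.\<close>
  define h where "h k x = (if norm x \<le> real k \<and> norm (f x) \<le> real k then f x else 0)" for k :: nat and x
  have [measurable]: "(norm :: 'a \<Rightarrow> real) \<in> borel_measurable lebesgue"
    by (rule measurable_completion) simp
  have [measurable]: "h k \<in> borel_measurable lebesgue" for k
    unfolding h_def[abs_def] by measurable
  have hle: "norm (h k x - f x) \<le> norm (f x)" for k x by (auto simp: h_def)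
  have hlim: "(\<lambda>k. h k x - f x) \<longlonglongrightarrow> 0" for x
  proof (rule tendsto_eventually)
    obtain K where "max (norm x) (norm (f x)) \<le> real K" using real_arch_simple by blast
    then show "\<forall>\<^sub>F k in sequentially. h k x - f x = 0"
      by (intro eventually_sequentiallyI[of K]) (auto simp: h_def)
  qed
  have hL: "h k \<in> L2" for k
    by (rule L2_dominated(1)[OF _ f, of _ 1]) (auto simp: h_def)
  have "(\<lambda>k. LINT x|lebesgue. (norm (h k x - f x))\<^sup>2) \<longlonglongrightarrow> (LINT x|(lebesgue :: 'a measure). 0)"
  proof (rule integral_dominated_convergence[where w="\<lambda>x. (norm (f x))\<^sup>2"])
    show "AE x in lebesgue. (\<lambda>k. (norm (h k x - f x))\<^sup>2) \<longlonglongrightarrow> 0"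
      using tendsto_power[OF tendsto_norm[OF hlim], where n=2] by (intro AE_I2) simp
    show "AE x in lebesgue. norm ((norm (h k x - f x))\<^sup>2) \<le> (norm (f x))\<^sup>2" for k
      using hle by (auto intro!: AE_I2 power_mono)
  qed (use L2_integrable[OF f] in auto)
  then have "(\<lambda>k. L2_norm (\<lambda>x. h k x - f x)) \<longlonglongrightarrow> 0"
    unfolding L2_norm_def by (auto intro: tendsto_eq_intros)
  then have "\<forall>\<^sub>F k in sequentially. L2_norm (\<lambda>x. h k x - f x) < e/2"
    by (rule order_tendstoD) (use \<open>e > 0\<close> in simp)
  moreover have "\<forall>\<^sub>F k in sequentially. integrable lebesgue f \<longrightarrow> (LINT x|lebesgue. norm (h k x - f x)) < e/2"
  proof (cases "integrable lebesgue f")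
    case True
    have "(\<lambda>k. LINT x|lebesgue. norm (h k x - f x)) \<longlonglongrightarrow> (LINT x|(lebesgue :: 'a measure). 0)"
    proof (rule integral_dominated_convergence[where w="\<lambda>x. norm (f x)"])
      show "AE x in lebesgue. (\<lambda>k. norm (h k x - f x)) \<longlonglongrightarrow> 0"
        using hlim by (auto intro!: AE_I2 tendsto_norm_zero)
    qed (use hle True in auto)
    then have "(\<lambda>k. LINT x|lebesgue. norm (h k x - f x)) \<longlonglongrightarrow> 0" by simp
    then have "\<forall>\<^sub>F k in sequentially. (LINT x|lebesgue. norm (h k x - f x)) < e/2"
      by (rule order_tendstoD) (use \<open>e > 0\<close> in simp)
    then show ?thesis by eventually_elim simp
  qed simp
  ultimately have "\<forall>\<^sub>F k in sequentially. k > 0 \<and> L2_norm (\<lambda>x. h k x - f x) < e/2 \<and>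
      (integrable lebesgue f \<longrightarrow> (LINT x|lebesgue. norm (h k x - f x)) < e/2)"
    using eventually_gt_at_top[of "0::nat"] by eventually_elim simp
  then obtain k where k: "k > 0" "L2_norm (\<lambda>x. h k x - f x) < e/2"
      "integrable lebesgue f \<Longrightarrow> (LINT x|lebesgue. norm (h k x - f x)) < e/2"
    using eventually_happens' trivial_limit_sequentially by blast
  obtain u where u: "u \<in> Cc" "L2_norm (\<lambda>x. u x - h k x) < e/2" "(LINT x|lebesgue. norm (u x - h k x)) < e/2"
  proof -
    have "norm (h k x) \<le> real k" "real k < norm x \<Longrightarrow> h k x = 0" for x
      by (auto simp: h_def)
    then show ?thesis
      using that Cc_approx_bounded[of "h k" "real k" "e/2"] k(1) \<open>e > 0\<close> by fastforce
  qed
  have "L2_norm (\<lambda>x. u x - f x) < e"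
    using L2_norm_triangle_diff[OF Cc_L2[OF u(1)] hL f, of k] u(2) k(2) by linarith
  moreover have "(LINT x|lebesgue. norm (u x - f x)) < e" if f1: "integrable lebesgue f"
  proof -
    have h1: "integrable lebesgue (h k)"
      by (rule Bochner_Integration.integrable_bound[OF f1]) (auto simp: h_def)
    note ints = Cc_integrable[OF u(1)] h1 f1
    have "(LINT x|lebesgue. norm (u x - f x)) \<le> (LINT x|lebesgue. norm (u x - h k x) + norm (h k x - f x))"
      using ints norm_triangle_ineq[of "u x - h k x" "h k x - f x" for x] by (intro integral_mono) auto
    also have "\<dots> = (LINT x|lebesgue. norm (u x - h k x)) + (LINT x|lebesgue. norm (h k x - f x))"
      using ints by (intro Bochner_Integration.integral_add) auto
    finally show ?thesis using u(3) k(3)[OF f1] by linarith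
  qed
  ultimately show ?thesis using u(1) by blast
qed

text \<open>For integrable \<open>f\<close> the same sequence converges in both norms: the L1
  convergence makes the Fourier integrals converge pointwise, the \<open>L2\<close> convergence
  controls their norms.\<close>

lemma Cc_dense:
  fixes f :: "'a::euclidean_space \<Rightarrow> 'b::euclidean_space"
  assumes f: "f \<in> L2"
  shows "\<exists>u. (\<forall>k. u k \<in> Cc) \<and> L2_tendsto u f \<and>
    (integrable lebesgue f \<longrightarrow> (\<lambda>k. LINT x|lebesgue. norm (u k x - f x)) \<longlonglongrightarrow> 0)"
proof -
  have "\<forall>k. \<exists>u\<in>Cc. L2_norm (\<lambda>x. u x - f x) < inverse (real (Suc k)) \<and>
           (integrable lebesgue f \<longrightarrow> (LINT x|lebesgue. norm (u x - f x)) < inverse (real (Suc k)))"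
    by (intro allI Cc_approx f) simp
  then obtain u where u: "\<And>k. u k \<in> Cc" "\<And>k. L2_norm (\<lambda>x. u k x - f x) < inverse (real (Suc k))"
      "\<And>k. integrable lebesgue f \<Longrightarrow> (LINT x|lebesgue. norm (u k x - f x)) < inverse (real (Suc k))"
    by metis
  have 1: "(\<lambda>k. L2_norm (\<lambda>x. u k x - f x)) \<longlonglongrightarrow> 0"
    by (rule Lim_null_comparison[OF always_eventually LIMSEQ_inverse_real_of_nat])
       (use less_imp_le[OF u(2)] in simp)
  have 2: "(\<lambda>k. LINT x|lebesgue. norm (u k x - f x)) \<longlonglongrightarrow> 0" if "integrable lebesgue f"
    by (rule Lim_null_comparison[OF always_eventually LIMSEQ_inverse_real_of_nat])
       (use less_imp_le[OF u(3)[OF that]] in simp)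
  have "L2_tendsto u f"
    unfolding L2_tendsto_def using 1 f Cc_L2[OF u(1)] by blast
  then show ?thesis using u(1) 2 by (intro exI[of _ u]) blast
qed

section \<open>The Gaussian and its Fourier transform\<close>

text \<open>Fubini for a bounded kernel, where the product of \<open>u\<close> and \<open>v\<close>
  dominates. It is used with the Fourier kernel and with its conjugate.\<close>

lemma kernel_multiplication:
  fixes k :: "'a::euclidean_space \<Rightarrow> 'a \<Rightarrow> complex"
  assumes k[measurable]: "(\<lambda>(x, y). k x y) \<in> borel_measurable (borel \<Otimes>\<^sub>M borel)"
    and k_le: "\<And>x y. cmod (k x y) \<le> 1"
    and u: "integrable lborel u" and v: "integrable lborel v"
  shows "(LINT x|lborel. (LINT y|lborel. k x y * u y) * v x) = (LINT y|lborel. u y * (LINT x|lborel. k x y * v x))"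
proof -
  have [measurable]: "u \<in> borel_measurable borel" "v \<in> borel_measurable borel"
    using u v by auto
  have k1[measurable]: "(\<lambda>y. k x y) \<in> borel_measurable borel" for x
    by measurable
  have *: "integrable lborel (\<lambda>y. k x y * u y * v x)" for x
  proof (rule Bochner_Integration.integrable_bound)
    show "integrable lborel (\<lambda>y. norm (u y) * norm (v x))"
      using u by simp
    show "AE y in lborel. norm (k x y * u y * v x) \<le> norm (norm (u y) * norm (v x))"
      using k_le[of x] by (auto simp: norm_mult intro!: mult_left_le_one_le mult_right_mono)
  qed measurable
  have int: "integrable (lborel \<Otimes>\<^sub>M lborel) (\<lambda>(x, y). k x y * u y * v x)"
  proof (rule lborel_pair.Fubini_integrable)
    show "integrable lborel (\<lambda>x. LINT y|lborel. norm (case (x, y) of (x, y) \<Rightarrow> k x y * u y * v x))"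
    proof (rule Bochner_Integration.integrable_bound)
      show "integrable lborel (\<lambda>x. (LINT y|lborel. norm (u y)) * norm (v x))"
        using v by simp
      have "(LINT y|lborel. norm (k x y * u y * v x)) \<le> (LINT y|lborel. norm (u y) * norm (v x))" for x
        by (rule integral_mono[OF integrable_norm[OF *]])
           (use u k_le[of x] in \<open>auto simp: norm_mult intro!: mult_left_le_one_le mult_right_mono\<close>)
      then show "AE x in lborel. norm (LINT y|lborel. norm (case (x, y) of (x, y) \<Rightarrow> k x y * u y * v x))
          \<le> norm ((LINT y|lborel. norm (u y)) * norm (v x))"
        using u by (intro AE_I2) (simp add: integral_nonneg)
    qed measurable
    show "AE x in lborel. integrable lborel (\<lambda>y. case (x, y) of (x, y) \<Rightarrow> k x y * u y * v x)"
      using * by simp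
  qed measurable
  have "(LINT x|lborel. (LINT y|lborel. k x y * u y) * v x) = (LINT x|lborel. LINT y|lborel. k x y * u y * v x)"
    by simp
  also have "\<dots> = (LINT y|lborel. LINT x|lborel. k x y * u y * v x)"
    by (rule lborel_pair.Fubini_integral[OF int, symmetric])
  also have "\<dots> = (LINT y|lborel. u y * (LINT x|lborel. k x y * v x))"
    by (subst integral_mult_right_zero[symmetric]) (simp add: mult_ac)
  finally show ?thesis .
qed

text \<open>\<open>lborel\<close> is by construction the image of a product measure indexed by
  \<open>Basis\<close>. This reduces the Gaussian to dimension one.\<close>

lemma lborel_integral_prod_Basis:
  fixes f :: "'a::euclidean_space \<Rightarrow> real \<Rightarrow> complex"
  assumes f: "\<And>b. b \<in> Basis \<Longrightarrow> integrable lborel (f b)"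
  shows "integrable lborel (\<lambda>x. \<Prod>b\<in>Basis. f b (x \<bullet> b))"
    and "(LINT x|lborel. (\<Prod>b\<in>Basis. f b (x \<bullet> b))) = (\<Prod>b\<in>Basis. LINT t|lborel. f b t)"
proof -
  interpret product_sigma_finite "\<lambda>_::'a. interval_measure (\<lambda>x. x)"
    unfolding lborel_eq_real[symmetric] ..
  have [measurable]: "f b \<in> borel_measurable borel" if "b \<in> Basis" for b
    using f[OF that] by auto
  have m: "(\<lambda>x. \<Prod>b\<in>Basis. f b (x \<bullet> b)) \<in> borel_measurable (borel :: 'a measure)"
    by measurable
  have T: "(\<lambda>x. \<Sum>b\<in>Basis. x b *\<^sub>R b) \<in> (\<Pi>\<^sub>M b\<in>Basis. interval_measure (\<lambda>x. x)) \<rightarrow>\<^sub>M (borel :: 'a measure)"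
    by measurable
  have eq: "(\<Prod>b\<in>Basis. f b ((\<Sum>c\<in>Basis. x c *\<^sub>R c) \<bullet> b)) = (\<Prod>b\<in>Basis. f b (x b))" for x :: "'a \<Rightarrow> real"
    by (intro prod.cong) simp_all
  show "integrable lborel (\<lambda>x. \<Prod>b\<in>Basis. f b (x \<bullet> b))"
    unfolding lborel_def integrable_distr_eq[OF T m] eq
    by (rule product_integrable_prod) (use f in \<open>auto simp: lborel_eq_real\<close>)
  show "(LINT x|lborel. (\<Prod>b\<in>Basis. f b (x \<bullet> b))) = (\<Prod>b\<in>Basis. LINT t|lborel. f b t)"
    unfolding lborel_def[where 'a='a] integral_distr[OF T m] eq lborel_eq_real
    by (rule product_integral_prod) (use f in \<open>auto simp: lborel_eq_real\<close>)
qed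

text \<open>Negative c is allowed because the energy computation reflects and dilates at once, with
  c = \<open>-\<epsilon>\<close>.\<close>

lemma lborel_integral_scale:
  fixes f :: "'a::euclidean_space \<Rightarrow> complex"
  assumes [measurable]: "f \<in> borel_measurable borel" and "c \<noteq> 0"
  shows "(LINT x|lborel. f x) = \<bar>c\<bar>^DIM('a) *\<^sub>R (LINT x|lborel. f (t + c *\<^sub>R x))"
    and "integrable lborel f \<longleftrightarrow> integrable lborel (\<lambda>x. f (t + c *\<^sub>R x))"
proof -
  let ?D = "distr lborel borel (\<lambda>x. t + c *\<^sub>R x)"
  note eq = lborel_affine[OF \<open>c \<noteq> 0\<close>, of t]
  have "(LINT x|lborel. f x) = (LINT x|density ?D (\<lambda>_. ennreal (\<bar>c\<bar>^DIM('a))). f x)"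
    by (rule arg_cong[OF eq[unfolded ennreal_power[OF abs_ge_zero]], of "\<lambda>M. integral\<^sup>L M f"])
  also have "\<dots> = (LINT x|?D. \<bar>c\<bar>^DIM('a) *\<^sub>R f x)"
    by (rule integral_density) auto
  also have "\<dots> = (LINT x|lborel. \<bar>c\<bar>^DIM('a) *\<^sub>R f (t + c *\<^sub>R x))"
    by (rule integral_distr) auto
  finally show "(LINT x|lborel. f x) = \<bar>c\<bar>^DIM('a) *\<^sub>R (LINT x|lborel. f (t + c *\<^sub>R x))"
    by simp
  have "integrable lborel f \<longleftrightarrow> integrable (density ?D (\<lambda>_. ennreal (\<bar>c\<bar>^DIM('a)))) f"
    by (rule arg_cong[OF eq[unfolded ennreal_power[OF abs_ge_zero]], of "\<lambda>M. integrable M f"])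
  also have "\<dots> \<longleftrightarrow> integrable ?D (\<lambda>x. \<bar>c\<bar>^DIM('a) *\<^sub>R f x)"
    by (rule integrable_density) auto
  also have "\<dots> \<longleftrightarrow> integrable lborel (\<lambda>x. \<bar>c\<bar>^DIM('a) *\<^sub>R f (t + c *\<^sub>R x))"
    by (rule integrable_distr_eq) auto
  also have "\<dots> \<longleftrightarrow> integrable lborel (\<lambda>x. f (t + c *\<^sub>R x))"
  proof
    assume "integrable lborel (\<lambda>x. \<bar>c\<bar>^DIM('a) *\<^sub>R f (t + c *\<^sub>R x))"
    then have "integrable lborel (\<lambda>x. (1 / \<bar>c\<bar>^DIM('a)) *\<^sub>R (\<bar>c\<bar>^DIM('a) *\<^sub>R f (t + c *\<^sub>R x)))"
      by (rule integrable_scaleR_right)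
    then show "integrable lborel (\<lambda>x. f (t + c *\<^sub>R x))"
      using \<open>c \<noteq> 0\<close> by simp
  qed (rule integrable_scaleR_right)
  finally show "integrable lborel f \<longleftrightarrow> integrable lborel (\<lambda>x. f (t + c *\<^sub>R x))" .
qed

text \<open>Substituting t = s / c turns the integral into the characteristic function of the
  standard normal law at \<open>- (c * w)\<close>. With c = sqrt (2 * pi) both exponents come out
  right, since c^2 / 2 = pi.\<close>

lemma fourier_gaussian_real:
  fixes w :: real
  shows "integrable lborel (\<lambda>t. exp (- 2 * of_real pi * \<i> * of_real (t * w)) * of_real (exp (- pi * t\<^sup>2)))" (is "integrable _ ?f")
    and "(LINT t|lborel. exp (- 2 * of_real pi * \<i> * of_real (t * w)) * of_real (exp (- pi * t\<^sup>2))) = of_real (exp (- pi * w\<^sup>2))"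
proof -
  define c where "c = sqrt (2 * pi)"
  have c: "c > 0" "c\<^sup>2 = 2 * pi" by (auto simp: c_def)
  have dens: "std_normal_density s = exp (- s\<^sup>2 / 2) / c" for s
    by (simp add: std_normal_density_def c_def)
  have f_eq: "?f (0 + (1/c) *\<^sub>R s) = c *\<^sub>R (std_normal_density s *\<^sub>R iexp (- (c * w) * s))" for s
  proof -
    have "pi * (s/c)\<^sup>2 = s\<^sup>2/2" using c by (simp add: power_divide field_simps)
    moreover have "2 * pi * (s/c * w) = c * w * s"
      using c by (simp add: field_simps power2_eq_square)
    then have "- 2 * of_real pi * \<i> * complex_of_real (s/c * w) = \<i> * of_real (- (c * w) * s)"
      by (metis (no_types, opaque_lifting) mult.assoc mult.commute mult_minus_left of_real_minus of_real_mult of_real_numeral)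
    ultimately show ?thesis using c(1)
      by (simp add: dens scaleR_conv_of_real)
  qed
  have n: "prob_space std_normal_distribution"
    using real_dist_normal_dist by (simp add: real_distribution_def)
  then have "integrable std_normal_distribution (\<lambda>s. iexp (- (c * w) * s))"
    by (intro finite_measure.integrable_const_bound[of _ _ 1] prob_space.finite_measure) auto
  then have i: "integrable lborel (\<lambda>s. std_normal_density s *\<^sub>R iexp (- (c * w) * s))"
    by (subst (asm) integrable_density) auto
  have mf: "?f \<in> borel_measurable borel" by measurable
  show "integrable lborel ?f"
  proof (subst lborel_integral_scale(2)[OF mf, of "1/c" 0])
    show "integrable lborel (\<lambda>s. ?f (0 + (1/c) *\<^sub>R s))"
      unfolding f_eq by (rule integrable_scaleR_right[OF i])
  qed (use c in simp)
  have "(LINT t|lborel. ?f t) = (LINT s|lborel. std_normal_density s *\<^sub>R iexp (- (c * w) * s))"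
  proof (subst lborel_integral_scale(1)[OF mf, of "1/c" 0])
    show "\<bar>1/c\<bar> ^ DIM(real) *\<^sub>R (LINT s|lborel. ?f (0 + (1/c) *\<^sub>R s))
        = (LINT s|lborel. std_normal_density s *\<^sub>R iexp (- (c * w) * s))"
      unfolding f_eq integral_scaleR_right using c(1) by simp
  qed (use c in simp)
  also have "\<dots> = char std_normal_distribution (- (c * w))"
    unfolding char_def by (subst integral_density) auto
  also have "\<dots> = of_real (exp (- pi * w\<^sup>2))"
    using c(2) by (simp add: char_std_normal_distribution power_mult_distrib)
  finally show "(LINT t|lborel. ?f t) = of_real (exp (- pi * w\<^sup>2))" .
qed

text \<open>The factor pi in the exponent makes this function its own Fourier transform, and hence
  of integral 1.\<close>

definition gaussian :: "'a::euclidean_space \<Rightarrow> real" where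
  "gaussian x = exp (- pi * (norm x)\<^sup>2)"

lemma gaussian_nonneg [simp]: "0 \<le> gaussian x"
  by (simp add: gaussian_def)

lemma gaussian_measurable [measurable]: "gaussian \<in> borel_measurable borel"
  unfolding gaussian_def[abs_def] by measurable

lemma gaussian_eq_prod: "gaussian x = (\<Prod>b\<in>Basis. exp (- pi * (x \<bullet> b)\<^sup>2))"
  unfolding gaussian_def power2_norm_eq_inner euclidean_inner[of x x]
  by (simp add: sum_distrib_left exp_sum power2_eq_square flip: sum_negf)

lemma fourier_gaussian:
  fixes w :: "'a::euclidean_space"
  shows "integrable lborel (\<lambda>x. exp (- 2 * of_real pi * \<i> * of_real (x \<bullet> w)) * of_real (gaussian x))" (is "integrable _ ?f")
    and "(LINT x|lborel. exp (- 2 * of_real pi * \<i> * of_real (x \<bullet> w)) * of_real (gaussian x)) = of_real (gaussian w)"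
proof -
  let ?g = "\<lambda>b t. exp (- 2 * of_real pi * \<i> * of_real (t * (w \<bullet> b))) * of_real (exp (- pi * t\<^sup>2))"
  have "of_real (gaussian x) = (\<Prod>b\<in>Basis. complex_of_real (exp (- pi * (x \<bullet> b)\<^sup>2)))" for x :: 'a
    by (simp add: gaussian_eq_prod)
  moreover have "exp (- 2 * of_real pi * \<i> * complex_of_real (x \<bullet> w)) =
      (\<Prod>b\<in>Basis. exp (- 2 * of_real pi * \<i> * of_real ((x \<bullet> b) * (w \<bullet> b))))" for x
    by (simp add: euclidean_inner[of x w] sum_distrib_left exp_sum flip: sum_negf)
  ultimately have f_eq: "?f x = (\<Prod>b\<in>Basis. ?g b (x \<bullet> b))" for x
    by (simp only: prod.distrib)
  show "integrable lborel ?f"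
    unfolding f_eq by (intro lborel_integral_prod_Basis fourier_gaussian_real)
  have "(LINT x|lborel. ?f x) = (\<Prod>b\<in>Basis. LINT t|lborel. ?g b t)"
    unfolding f_eq by (intro lborel_integral_prod_Basis fourier_gaussian_real)
  also have "\<dots> = (\<Prod>b\<in>Basis. of_real (exp (- pi * (w \<bullet> b)\<^sup>2)))"
    by (simp only: fourier_gaussian_real(2))
  also have "\<dots> = of_real (gaussian w)"
    by (simp add: gaussian_eq_prod)
  finally show "(LINT x|lborel. ?f x) = of_real (gaussian w)" .
qed

lemma gaussian_integrable [simp]: "integrable lborel (gaussian :: 'a::euclidean_space \<Rightarrow> real)"
  and gaussian_integral [simp]: "(LINT x|lborel. gaussian (x :: 'a)) = 1"
proof -
  have "gaussian (0 :: 'a) = 1" by (simp add: gaussian_def)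
  then show "integrable lborel (gaussian :: 'a \<Rightarrow> real)" "(LINT x|lborel. gaussian (x :: 'a)) = 1"
    using fourier_gaussian[of "0 :: 'a"] by (simp_all add: complex_of_real_integrable_eq)
qed

section \<open>The Fourier integral on compactly supported functions\<close>

lemma borel_measurable_cnj [measurable]: "cnj \<in> borel_measurable borel"
  by (intro borel_measurable_continuous_onI continuous_intros)

text \<open>Fubini and the substitution rule are applied over \<open>lborel\<close>, while the
  transform is defined over its completion.\<close>

lemma fourier_lborel:
  assumes "f \<in> borel_measurable borel"
  shows "fourier f \<xi> = (LINT x|lborel. exp (- 2 * of_real pi * \<i> * of_real (\<xi> \<bullet> x)) * f x)"
  unfolding fourier_def using assms by (intro integral_completion) measurable

lemma norm_fourier_kernel [simp]: "cmod (exp (- 2 * of_real pi * \<i> * of_real t)) = 1"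
  by (simp add: norm_exp_eq_Re)

lemma fourier_integrand_integrable:
  assumes "integrable lebesgue f"
  shows "integrable lebesgue (\<lambda>x. exp (- 2 * of_real pi * \<i> * of_real (\<xi> \<bullet> x)) * f x)"
proof (rule Bochner_Integration.integrable_bound[OF assms])
  have "(\<lambda>x. exp (- 2 * of_real pi * \<i> * of_real (\<xi> \<bullet> x))) \<in> borel_measurable lebesgue"
    by (rule measurable_completion) measurable
  then show "(\<lambda>x. exp (- 2 * of_real pi * \<i> * of_real (\<xi> \<bullet> x)) * f x) \<in> borel_measurable lebesgue"
    using assms by measurable
qed (simp add: norm_mult)

lemma fourier_diff:
  assumes "integrable lebesgue f" "integrable lebesgue g"
  shows "fourier (\<lambda>x. f x - g x) = (\<lambda>\<xi>. fourier f \<xi> - fourier g \<xi>)"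
  unfolding fourier_def right_diff_distrib fun_eq_iff
  by (intro allI Bochner_Integration.integral_diff fourier_integrand_integrable assms)

lemma norm_fourier_le:
  assumes "integrable lebesgue f"
  shows "cmod (fourier f \<xi>) \<le> (LINT x|lebesgue. cmod (f x))"
proof -
  have "cmod (fourier f \<xi>) \<le> (LINT x|lebesgue. cmod (exp (- 2 * of_real pi * \<i> * of_real (\<xi> \<bullet> x)) * f x))"
    unfolding fourier_def by (rule integral_norm_bound)
  then show ?thesis by (simp add: norm_mult)
qed

text \<open>Dominated convergence along sequences. Continuity matters as the source of Borel
  measurability of the transform.\<close>

lemma continuous_fourier:
  assumes f: "integrable lebesgue f"
  shows "continuous_on UNIV (fourier f)"
  unfolding continuous_on_sequentially
proof (intro ballI allI impI)
  fix X and \<xi> :: 'a assume "(\<forall>n. X n \<in> UNIV) \<and> X \<longlonglongrightarrow> \<xi>"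
  then have X: "X \<longlonglongrightarrow> \<xi>" by simp
  have "(\<lambda>n. LINT x|lebesgue. exp (- 2 * of_real pi * \<i> * of_real (X n \<bullet> x)) * f x)
      \<longlonglongrightarrow> (LINT x|lebesgue. exp (- 2 * of_real pi * \<i> * of_real (\<xi> \<bullet> x)) * f x)"
  proof (rule integral_dominated_convergence[where w="\<lambda>x. norm (f x)"])
    show "AE x in lebesgue. (\<lambda>n. exp (- 2 * of_real pi * \<i> * of_real (X n \<bullet> x)) * f x)
        \<longlonglongrightarrow> exp (- 2 * of_real pi * \<i> * of_real (\<xi> \<bullet> x)) * f x"
      by (intro AE_I2 tendsto_intros X)
  qed (use f fourier_integrand_integrable[OF f] in \<open>auto simp: norm_mult intro: borel_measurable_integrable\<close>)
  then show "(fourier f \<circ> X) \<longlonglongrightarrow> fourier f \<xi>"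
    by (simp add: fourier_def o_def)
qed

lemma fourier_measurable:
  assumes "integrable lebesgue f"
  shows "fourier f \<in> borel_measurable borel"
  using continuous_fourier[OF assms] by (rule borel_measurable_continuous_onI)

lemma fourier_measurable_lebesgue:
  assumes "integrable lebesgue f"
  shows "fourier f \<in> borel_measurable lebesgue"
  using fourier_measurable[OF assms] by (intro measurable_completion) simp

text \<open>Fubini together with the symmetry of the kernel in its two arguments.\<close>

lemma fourier_mult_Cc:
  fixes u v :: "'a::euclidean_space \<Rightarrow> complex"
  assumes u: "u \<in> Cc" and v: "v \<in> Cc"
  shows "(LINT \<xi>|lebesgue. fourier u \<xi> * v \<xi>) = (LINT \<xi>|lebesgue. u \<xi> * fourier v \<xi>)"
proof -
  note m[measurable] = Cc_borel_measurable[OF u] Cc_borel_measurable[OF v]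
    fourier_measurable[OF Cc_integrable[OF u]] fourier_measurable[OF Cc_integrable[OF v]]
  have "(LINT \<xi>|lebesgue. fourier u \<xi> * v \<xi>) = (LINT \<xi>|lborel. fourier u \<xi> * v \<xi>)"
    by (rule integral_completion) measurable
  also have "\<dots> = (LINT \<xi>|lborel. (LINT x|lborel. exp (- 2 * of_real pi * \<i> * of_real (\<xi> \<bullet> x)) * u x) * v \<xi>)"
    by (simp only: fourier_lborel[OF m(1)])
  also have "\<dots> = (LINT x|lborel. u x * (LINT \<xi>|lborel. exp (- 2 * of_real pi * \<i> * of_real (\<xi> \<bullet> x)) * v \<xi>))"
    by (rule kernel_multiplication) (simp_all only: norm_fourier_kernel order_refl Cc_integrable_lborel u v, measurable)
  also have "\<dots> = (LINT x|lborel. u x * fourier v x)"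
    by (simp only: fourier_lborel[OF m(2)] inner_commute)
  also have "\<dots> = (LINT x|lebesgue. u x * fourier v x)"
    by (rule integral_completion[symmetric]) measurable
  finally show ?thesis .
qed

text \<open>A wide Gaussian has a narrow transform of mass 1: damping by a slowly decaying factor in
  frequency is averaging over distances of order \<open>\<epsilon>\<close> in space.\<close>

lemma fourier_dilated_gaussian:
  fixes w :: "'a::euclidean_space"
  assumes "\<epsilon> > 0"
  shows "(LINT \<xi>|lborel. exp (- 2 * of_real pi * \<i> * of_real (\<xi> \<bullet> w)) * of_real (gaussian (\<epsilon> *\<^sub>R \<xi>)))
       = of_real ((1/\<epsilon>)^DIM('a) * gaussian (w /\<^sub>R \<epsilon>))"
    and "integrable lborel (\<lambda>\<xi>::'a. gaussian (\<epsilon> *\<^sub>R \<xi>))"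
proof -
  let ?f = "\<lambda>\<xi>::'a. exp (- 2 * of_real pi * \<i> * of_real (\<xi> \<bullet> w)) * of_real (gaussian (\<epsilon> *\<^sub>R \<xi>))"
  have eq: "?f (0 + (1/\<epsilon>) *\<^sub>R \<eta>) = exp (- 2 * of_real pi * \<i> * of_real (\<eta> \<bullet> (w /\<^sub>R \<epsilon>))) * of_real (gaussian \<eta>)" for \<eta>
    using assms by (simp add: divide_inverse mult_ac)
  have "(LINT \<xi>|lborel. ?f \<xi>) = \<bar>1/\<epsilon>\<bar>^DIM('a) *\<^sub>R (LINT \<eta>|lborel. ?f (0 + (1/\<epsilon>) *\<^sub>R \<eta>))"
    by (rule lborel_integral_scale) (use assms in auto)
  also have "\<dots> = of_real ((1/\<epsilon>)^DIM('a) * gaussian (w /\<^sub>R \<epsilon>))"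
    unfolding eq fourier_gaussian(2) using assms by (simp add: scaleR_conv_of_real)
  finally show "(LINT \<xi>|lborel. ?f \<xi>) = of_real ((1/\<epsilon>)^DIM('a) * gaussian (w /\<^sub>R \<epsilon>))" .
  have "integrable lborel (\<lambda>\<xi>::'a. complex_of_real (gaussian \<xi>))"
    by (simp add: complex_of_real_integrable_eq)
  then have "integrable lborel (\<lambda>\<xi>::'a. complex_of_real (gaussian (\<epsilon> *\<^sub>R \<xi>)))"
    using lborel_integral_scale(2)[of "\<lambda>\<xi>::'a. complex_of_real (gaussian \<xi>)" \<epsilon> 0] assms by simp
  then show "integrable lborel (\<lambda>\<xi>::'a. gaussian (\<epsilon> *\<^sub>R \<xi>))"
    by (simp add: complex_of_real_integrable_eq)
qed

text \<open>Damping by a Gaussian makes the energy of the transform an absolutely convergent double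
  integral, which Fubini turns into an average of the autocorrelation of \<open>u\<close>.\<close>

lemma damped_energy:
  fixes u :: "'a::euclidean_space \<Rightarrow> complex"
  assumes u: "u \<in> Cc" and "\<epsilon> > 0"
  shows "integrable lborel (\<lambda>\<xi>. (cmod (fourier u \<xi>))\<^sup>2 * gaussian (\<epsilon> *\<^sub>R \<xi>))" (is ?int)
    and "complex_of_real (LINT \<xi>|lborel. (cmod (fourier u \<xi>))\<^sup>2 * gaussian (\<epsilon> *\<^sub>R \<xi>))
       = (LINT x|lborel. u x * (LINT z|lborel. cnj (u (x - \<epsilon> *\<^sub>R z)) * of_real (gaussian z)))" (is ?eq)
proof -
  let ?e = "\<lambda>\<xi> x :: 'a. exp (- 2 * of_real pi * \<i> * complex_of_real (\<xi> \<bullet> x))"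
  note mu[measurable] = Cc_borel_measurable[OF u] and mf[measurable] = fourier_measurable[OF Cc_integrable[OF u]]
  note g_int = fourier_dilated_gaussian(2)[OF \<open>\<epsilon> > 0\<close>, where ?'a='a]
  let ?K = "LINT x|lebesgue. cmod (u x)"
  have K: "cmod (fourier u \<xi>) \<le> ?K" for \<xi> by (rule norm_fourier_le[OF Cc_integrable[OF u]])
  have K0: "0 \<le> ?K" by simp
  have v_int: "integrable lborel (\<lambda>\<xi>. cnj (fourier u \<xi>) * of_real (gaussian (\<epsilon> *\<^sub>R \<xi>)))"
  proof (rule Bochner_Integration.integrable_bound)
    show "integrable lborel (\<lambda>\<xi>::'a. ?K * gaussian (\<epsilon> *\<^sub>R \<xi>))" using g_int by simp
    show "AE \<xi> in lborel. norm (cnj (fourier u \<xi>) * of_real (gaussian (\<epsilon> *\<^sub>R \<xi>))) \<le> norm (?K * gaussian (\<epsilon> *\<^sub>R \<xi>))"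
      using K K0 by (intro AE_I2) (simp add: norm_mult mult_right_mono)
  qed measurable
  have sq: "fourier u \<xi> * (cnj (fourier u \<xi>) * of_real (gaussian (\<epsilon> *\<^sub>R \<xi>))) = of_real ((cmod (fourier u \<xi>))\<^sup>2 * gaussian (\<epsilon> *\<^sub>R \<xi>))" for \<xi>
    by (simp only: of_real_mult complex_norm_square mult.assoc)
  show ?int
  proof (rule Bochner_Integration.integrable_bound)
    show "integrable lborel (\<lambda>\<xi>::'a. ?K\<^sup>2 * gaussian (\<epsilon> *\<^sub>R \<xi>))" using g_int by simp
    have "(cmod (fourier u \<xi>))\<^sup>2 * gaussian (\<epsilon> *\<^sub>R \<xi>) \<le> ?K\<^sup>2 * gaussian (\<epsilon> *\<^sub>R \<xi>)" for \<xi>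
      using K by (intro mult_right_mono power_mono) auto
    then show "AE \<xi> in lborel. norm ((cmod (fourier u \<xi>))\<^sup>2 * gaussian (\<epsilon> *\<^sub>R \<xi>)) \<le> norm (?K\<^sup>2 * gaussian (\<epsilon> *\<^sub>R \<xi>))"
      by (intro AE_I2) simp
  qed measurable
  \<comment> \<open>A second Fubini, for the conjugated transform: the frequency integral that
    remains is the transform of the dilated Gaussian at x - y.\<close>
  have inner: "(LINT \<xi>|lborel. ?e \<xi> x * (cnj (fourier u \<xi>) * of_real (gaussian (\<epsilon> *\<^sub>R \<xi>))))
      = (LINT z|lborel. cnj (u (x - \<epsilon> *\<^sub>R z)) * of_real (gaussian z))" for x
  proof -
    have c: "cnj (fourier u \<xi>) = (LINT y|lborel. cnj (?e \<xi> y) * cnj (u y))" for \<xi>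
      unfolding fourier_lborel[OF mu] complex_cnj_mult[symmetric]
      by (rule Bochner_Integration.integral_cnj[symmetric])
    have "(LINT \<xi>|lborel. ?e \<xi> x * (cnj (fourier u \<xi>) * of_real (gaussian (\<epsilon> *\<^sub>R \<xi>))))
        = (LINT \<xi>|lborel. (LINT y|lborel. cnj (?e \<xi> y) * cnj (u y)) * (?e \<xi> x * of_real (gaussian (\<epsilon> *\<^sub>R \<xi>))))"
      by (simp only: c mult_ac)
    also have "\<dots> = (LINT y|lborel. cnj (u y) * (LINT \<xi>|lborel. cnj (?e \<xi> y) * (?e \<xi> x * of_real (gaussian (\<epsilon> *\<^sub>R \<xi>)))))"
    proof (rule kernel_multiplication)
      show "integrable lborel (\<lambda>y. cnj (u y))" using Cc_integrable_lborel[OF u] by simp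
      show "integrable lborel (\<lambda>\<xi>. ?e \<xi> x * of_real (gaussian (\<epsilon> *\<^sub>R \<xi>)))"
        by (rule Bochner_Integration.integrable_bound[OF g_int]) (auto simp: norm_mult)
      show "cmod (cnj (?e \<xi> y)) \<le> 1" for \<xi> y
        by (simp only: complex_mod_cnj norm_fourier_kernel order_refl)
    qed measurable
    also have "\<dots> = (LINT y|lborel. cnj (u y) * of_real ((1/\<epsilon>)^DIM('a) * gaussian ((x - y) /\<^sub>R \<epsilon>)))"
    proof -
      have "cnj (?e \<xi> y) * ?e \<xi> x = ?e \<xi> (x - y)" for \<xi> y
      proof -
        have "cnj (?e \<xi> y) = exp (2 * of_real pi * \<i> * complex_of_real (\<xi> \<bullet> y))"
          by (simp add: exp_cnj)
        then show ?thesis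
          unfolding exp_add[symmetric] by (simp only: exp_add[symmetric], intro arg_cong[of _ _ exp])
            (simp add: inner_diff_right algebra_simps)
      qed
      then show ?thesis
        by (simp only: mult.assoc[symmetric] fourier_dilated_gaussian(1)[OF \<open>\<epsilon> > 0\<close>])
    qed
    \<comment> \<open>Substitution of y = x - \<open>\<epsilon>\<close> z. The Jacobian cancels the
      factor in front of the dilated Gaussian, whose argument becomes z.\<close>
    also have "\<dots> = \<bar>-\<epsilon>\<bar>^DIM('a) *\<^sub>R (LINT z|lborel. cnj (u (x + (-\<epsilon>) *\<^sub>R z)) *
        of_real ((1/\<epsilon>)^DIM('a) * gaussian ((x - (x + (-\<epsilon>) *\<^sub>R z)) /\<^sub>R \<epsilon>)))"
      by (rule lborel_integral_scale) (use \<open>\<epsilon> > 0\<close> in auto)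
    also have "\<dots> = (LINT z|lborel. \<bar>-\<epsilon>\<bar>^DIM('a) *\<^sub>R (cnj (u (x + (-\<epsilon>) *\<^sub>R z)) *
        of_real ((1/\<epsilon>)^DIM('a) * gaussian ((x - (x + (-\<epsilon>) *\<^sub>R z)) /\<^sub>R \<epsilon>))))"
      by (rule integral_scaleR_right[symmetric])
    also have "\<dots> = (LINT z|lborel. cnj (u (x - \<epsilon> *\<^sub>R z)) * of_real (gaussian z))"
      using \<open>\<epsilon> > 0\<close> by (simp add: scaleR_conv_of_real power_divide)
    finally show ?thesis .
  qed
  have "complex_of_real (LINT \<xi>|lborel. (cmod (fourier u \<xi>))\<^sup>2 * gaussian (\<epsilon> *\<^sub>R \<xi>))
      = (LINT \<xi>|lborel. fourier u \<xi> * (cnj (fourier u \<xi>) * of_real (gaussian (\<epsilon> *\<^sub>R \<xi>))))"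
    by (simp only: sq integral_complex_of_real)
  also have "\<dots> = (LINT \<xi>|lborel. (LINT x|lborel. ?e \<xi> x * u x) * (cnj (fourier u \<xi>) * of_real (gaussian (\<epsilon> *\<^sub>R \<xi>))))"
    by (subst (1) fourier_lborel[OF mu]) (rule refl)
  also have "\<dots> = (LINT x|lborel. u x * (LINT \<xi>|lborel. ?e \<xi> x * (cnj (fourier u \<xi>) * of_real (gaussian (\<epsilon> *\<^sub>R \<xi>)))))"
    by (rule kernel_multiplication) (simp_all only: norm_fourier_kernel order_refl Cc_integrable_lborel[OF u] v_int, measurable)
  finally show ?eq unfolding inner .
qed

text \<open>The Gaussian averages form an approximate identity. Dominated convergence is used twice:
  inside by continuity and boundedness of \<open>u\<close>, outside because the averages inherit the
  bound \<open>M\<close> and \<open>u\<close> is integrable.\<close>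

lemma autocorrelation_limit:
  fixes u :: "'a::euclidean_space \<Rightarrow> complex"
  assumes u: "u \<in> Cc" and \<epsilon>: "\<epsilon> \<longlonglongrightarrow> 0"
  shows "(\<lambda>k::nat. LINT x|lborel. u x * (LINT z|lborel. cnj (u (x - \<epsilon> k *\<^sub>R z)) * of_real (gaussian z)))
     \<longlonglongrightarrow> of_real (LINT x|lborel. (cmod (u x))\<^sup>2)"
proof -
  obtain M where M: "0 \<le> M" "\<And>x. cmod (u x) \<le> M" using Cc_bounded[OF u] by blast
  note mu[measurable] = Cc_borel_measurable[OF u]
  have cont: "isCont u x" for x
    using u by (simp add: Cc_def continuous_on_eq_continuous_at)
  have bd: "norm (cnj (u (x - \<epsilon> k *\<^sub>R z)) * of_real (gaussian z)) \<le> M * gaussian z" for x z k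
    using M by (simp add: norm_mult mult_right_mono)
  have gM: "integrable lborel (\<lambda>z::'a. M * gaussian z)" by simp
  have inner: "(\<lambda>k. LINT z|lborel. cnj (u (x - \<epsilon> k *\<^sub>R z)) * of_real (gaussian z)) \<longlonglongrightarrow> cnj (u x)" for x
  proof -
    have "(\<lambda>k. LINT z|lborel. cnj (u (x - \<epsilon> k *\<^sub>R z)) * of_real (gaussian z))
        \<longlonglongrightarrow> (LINT z|lborel. cnj (u x) * of_real (gaussian (z::'a)))"
    proof (rule integral_dominated_convergence[where w="\<lambda>z::'a. M * gaussian z"])
      have "(\<lambda>k. u (x - \<epsilon> k *\<^sub>R z)) \<longlonglongrightarrow> u (x - 0 *\<^sub>R z)" for z
        by (rule isCont_tendsto_compose[OF cont]) (intro tendsto_intros \<epsilon>)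
      then have "(\<lambda>k. u (x - \<epsilon> k *\<^sub>R z)) \<longlonglongrightarrow> u x" for z
        by simp
      then show "AE z in lborel. (\<lambda>k. cnj (u (x - \<epsilon> k *\<^sub>R z)) * of_real (gaussian z)) \<longlonglongrightarrow> cnj (u x) * of_real (gaussian z)"
        by (intro AE_I2 tendsto_intros)
    qed (use bd gM in auto)
    then show ?thesis by simp
  qed
  have inner_le: "cmod (LINT z|lborel. cnj (u (x - \<epsilon> k *\<^sub>R z)) * of_real (gaussian z)) \<le> M" for x k
  proof -
    have "cmod (LINT z|lborel. cnj (u (x - \<epsilon> k *\<^sub>R z)) * of_real (gaussian z)) \<le> (LINT z|lborel. M * gaussian (z :: 'a))"
      by (rule Bochner_Integration.integral_norm_bound_integral[OF Bochner_Integration.integrable_bound[OF gM] gM bd])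
         (use order_trans[OF bd abs_ge_self] in auto)
    then show ?thesis by simp
  qed
  have "(\<lambda>k. LINT x|lborel. u x * (LINT z|lborel. cnj (u (x - \<epsilon> k *\<^sub>R z)) * of_real (gaussian z)))
      \<longlonglongrightarrow> (LINT x|lborel. u x * cnj (u x))"
  proof (rule integral_dominated_convergence[where w="\<lambda>x. cmod (u x) * M"])
    show "integrable lborel (\<lambda>x. cmod (u x) * M)" using Cc_integrable_lborel[OF u] by simp
    show "AE x in lborel. (\<lambda>k. u x * (LINT z|lborel. cnj (u (x - \<epsilon> k *\<^sub>R z)) * of_real (gaussian z))) \<longlonglongrightarrow> u x * cnj (u x)"
      by (intro AE_I2 tendsto_intros inner)
    show "AE x in lborel. norm (u x * (LINT z|lborel. cnj (u (x - \<epsilon> k *\<^sub>R z)) * of_real (gaussian z))) \<le> cmod (u x) * M" for k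
      unfolding norm_mult by (intro AE_I2 mult_left_mono inner_le norm_ge_zero)
  qed measurable
  also have "(LINT x|lborel. u x * cnj (u x)) = of_real (LINT x|lborel. (cmod (u x))\<^sup>2)"
    by (simp only: complex_norm_square[symmetric] integral_complex_of_real)
  finally show ?thesis .
qed

text \<open>As \<open>\<epsilon> k\<close> decreases to 0 the damping factors increase to 1.
  Monotone convergence then yields the integrability of the squared transform together with its
  integral, whereas dominated convergence would presuppose that integrability.\<close>

lemma Plancherel_Cc:
  fixes u :: "'a::euclidean_space \<Rightarrow> complex"
  assumes u: "u \<in> Cc"
  shows "fourier u \<in> L2" "L2_norm (fourier u) = L2_norm u"
proof -
  note [measurable] = Cc_borel_measurable[OF u] fourier_measurable[OF Cc_integrable[OF u]]
  define \<epsilon> where "\<epsilon> k = inverse (real (Suc k))" for k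
  have \<epsilon>: "\<epsilon> k > 0" "\<epsilon> \<longlonglongrightarrow> 0" for k
    using LIMSEQ_inverse_real_of_nat by (auto simp: \<epsilon>_def[abs_def])
  have \<epsilon>_mono: "\<epsilon> l \<le> \<epsilon> k" if "k \<le> l" for k l using that by (simp add: \<epsilon>_def)
  let ?f = "\<lambda>k \<xi>. (cmod (fourier u \<xi>))\<^sup>2 * gaussian (\<epsilon> k *\<^sub>R \<xi>)"
  have 1: "integrable lborel (?f k)" for k by (rule damped_energy[OF u \<epsilon>(1)])
  have 2: "AE \<xi> in lborel. mono (\<lambda>k. ?f k \<xi>)"
  proof (intro AE_I2 monoI mult_left_mono)
    fix \<xi> :: 'a and k l :: nat assume "k \<le> l"
    then have "norm (\<epsilon> l *\<^sub>R \<xi>) \<le> norm (\<epsilon> k *\<^sub>R \<xi>)"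
      using \<epsilon>(1)[of l] \<epsilon>(1)[of k] \<epsilon>_mono[OF \<open>k \<le> l\<close>] by (auto intro!: mult_right_mono)
    then show "gaussian (\<epsilon> k *\<^sub>R \<xi>) \<le> gaussian (\<epsilon> l *\<^sub>R \<xi>)"
      unfolding gaussian_def by (simp only: exp_le_cancel_iff) (auto intro: power_mono)
  qed simp
  have 3: "AE \<xi> in lborel. (\<lambda>k. ?f k \<xi>) \<longlonglongrightarrow> (cmod (fourier u \<xi>))\<^sup>2"
  proof (intro AE_I2)
    fix \<xi> :: 'a
    have "(\<lambda>k. ?f k \<xi>) \<longlonglongrightarrow> (cmod (fourier u \<xi>))\<^sup>2 * exp (- pi * (norm (0 *\<^sub>R \<xi>))\<^sup>2)"
      unfolding gaussian_def by (intro tendsto_intros \<epsilon>)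
    then show "(\<lambda>k. ?f k \<xi>) \<longlonglongrightarrow> (cmod (fourier u \<xi>))\<^sup>2" by simp
  qed
  have 4: "(\<lambda>k. integral\<^sup>L lborel (?f k)) \<longlonglongrightarrow> (LINT x|lborel. (cmod (u x))\<^sup>2)"
    using autocorrelation_limit[OF u \<epsilon>(2)] by (simp only: damped_energy(2)[OF u \<epsilon>(1), symmetric] tendsto_of_real_iff)
  have 5: "(\<lambda>\<xi>. (cmod (fourier u \<xi>))\<^sup>2) \<in> borel_measurable lborel" by measurable
  have "integrable lborel (\<lambda>\<xi>. (cmod (fourier u \<xi>))\<^sup>2)"
    by (rule integrable_monotone_convergence[OF 1 2 3 4 5])
  then show "fourier u \<in> L2"
    by (intro L2_I[OF fourier_measurable_lebesgue[OF Cc_integrable[OF u]]]) (simp add: integrable_completion)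
  have "(LINT \<xi>|lborel. (cmod (fourier u \<xi>))\<^sup>2) = (LINT x|lborel. (cmod (u x))\<^sup>2)"
    by (rule integral_monotone_convergence[OF 1 2 3 4 5])
  then show "L2_norm (fourier u) = L2_norm u"
    unfolding L2_norm_def by (simp add: integral_completion)
qed

section \<open>The Fourier transform on \<open>L\<^sup>2\<close>\<close>

text \<open>The approximants converge in L1, so their transforms converge pointwise; Fatou then
  gives one inequality. Equality needs norm convergence of the transforms, which this inequality
  will provide when applied to differences.\<close>

lemma Plancherel_le:
  fixes u :: "'a::euclidean_space \<Rightarrow> complex"
  assumes u: "integrable lebesgue u" "u \<in> L2"
  shows "fourier u \<in> L2 \<and> L2_norm (fourier u) \<le> L2_norm u"
proof -
  obtain v where v: "\<And>k. v k \<in> Cc" "L2_tendsto v u"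
    and v1: "(\<lambda>k. LINT x|lebesgue. norm (v k x - u x)) \<longlonglongrightarrow> 0"
    using Cc_dense[OF u(2)] u(1) by blast
  note vi = Cc_integrable[OF v(1)]
  have "(\<lambda>k. fourier (v k) \<xi>) \<longlonglongrightarrow> fourier u \<xi>" for \<xi>
  proof (rule LIM_zero_cancel, rule Lim_null_comparison[OF always_eventually v1], intro allI)
    show "norm (fourier (v k) \<xi> - fourier u \<xi>) \<le> (LINT x|lebesgue. norm (v k x - u x))" for k
      using norm_fourier_le[of "\<lambda>x. v k x - u x" \<xi>] vi[of k] u(1) by (simp add: fourier_diff)
  qed
  then have lim: "AE \<xi> in lebesgue. (\<lambda>k. fourier (v k) \<xi>) \<longlonglongrightarrow> fourier u \<xi>"
    by simp
  \<comment> \<open>The norms of the approximants only tend to that of \<open>u\<close>, hence the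
    slack e, removed at the end.\<close>
  have *: "fourier u \<in> L2 \<and> L2_norm (fourier u) \<le> L2_norm u + e" if "e > 0" for e
  proof -
    have "\<forall>\<^sub>F k in sequentially. L2_norm (v k) < L2_norm u + e"
      using L2_tendsto_norm[OF v(2)] by (rule order_tendstoD) (use that in simp)
    then obtain J where "\<And>k. k \<ge> J \<Longrightarrow> L2_norm (fourier (v k)) \<le> L2_norm u + e"
      by (auto simp: eventually_sequentially Plancherel_Cc[OF v(1)] intro: less_imp_le)
    then show ?thesis
      using L2_Fatou[OF Plancherel_Cc(1)[OF v(1)] fourier_measurable_lebesgue[OF u(1)] lim] by blast
  qed
  show ?thesis
    using *[of 1] * by (auto intro: field_le_epsilon)
qed

text \<open>By the inequality for \<open>v k - u\<close>, the transforms of the approximants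
  converge in norm, and the equality known for \<open>Cc\<close> passes to the limit.\<close>

theorem Plancherel:
  fixes u :: "'a::euclidean_space \<Rightarrow> complex"
  assumes u: "integrable lebesgue u" "u \<in> L2"
  shows "fourier u \<in> L2" "L2_norm (fourier u) = L2_norm u"
proof -
  show fu: "fourier u \<in> L2" using Plancherel_le[OF u] by simp
  obtain v where v: "\<And>k. v k \<in> Cc" "L2_tendsto v u"
    using Cc_dense[OF u(2)] by blast
  have "L2_norm (\<lambda>\<xi>. fourier (v k) \<xi> - fourier u \<xi>) \<le> L2_norm (\<lambda>x. v k x - u x)" for k
    using Plancherel_le[of "\<lambda>x. v k x - u x"] L2_diff[OF Cc_L2[OF v(1)[of k]] u(2)] Cc_integrable[OF v(1)[of k]] u(1)
    by (simp add: fourier_diff)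
  then have "(\<lambda>k. L2_norm (\<lambda>\<xi>. fourier (v k) \<xi> - fourier u \<xi>)) \<longlonglongrightarrow> 0"
    by (intro Lim_null_comparison[OF always_eventually L2_tendstoD(3)[OF v(2)]]) simp
  then have "L2_tendsto (\<lambda>k. fourier (v k)) (fourier u)"
    unfolding L2_tendsto_def using fu Plancherel_Cc(1)[OF v(1)] by blast
  then have "(\<lambda>k. L2_norm (fourier (v k))) \<longlonglongrightarrow> L2_norm (fourier u)"
    by (rule L2_tendsto_norm)
  then have "(\<lambda>k. L2_norm (v k)) \<longlonglongrightarrow> L2_norm (fourier u)"
    by (simp only: Plancherel_Cc(2)[OF v(1)])
  then show "L2_norm (fourier u) = L2_norm u"
    using LIMSEQ_unique L2_tendsto_norm[OF v(2)] by blast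
qed

section \<open>The transform on \<open>L2\<close> as a relation\<close>

text \<open>The property under the choice operator in \<open>fourier_L2\<close>. As a relation it
  can be added, subtracted and changed on null sets without mentioning a chosen
  representative.\<close>

definition is_fourier_L2 :: "('a::euclidean_space \<Rightarrow> complex) \<Rightarrow> ('a \<Rightarrow> complex) \<Rightarrow> bool" where
  "is_fourier_L2 f g \<longleftrightarrow> (\<exists>u. (\<forall>k. integrable lebesgue (u k)) \<and> L2_tendsto u f \<and> L2_tendsto (\<lambda>k. fourier (u k)) g)"

lemma is_fourier_L2_in_L2:
  assumes "is_fourier_L2 f g" shows "f \<in> L2" "g \<in> L2"
  using assms by (auto simp: is_fourier_L2_def L2_tendsto_def)

lemma is_fourier_L2_norm:
  assumes "is_fourier_L2 f g" shows "L2_norm g = L2_norm f"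
proof -
  obtain u where u: "\<And>k. integrable lebesgue (u k)" "L2_tendsto u f" "L2_tendsto (\<lambda>k. fourier (u k)) g"
    using assms by (auto simp: is_fourier_L2_def)
  have "L2_norm (fourier (u k)) = L2_norm (u k)" for k
    by (rule Plancherel(2)[OF u(1) L2_tendstoD(1)[OF u(2)]])
  then show ?thesis
    using L2_tendsto_norm[OF u(2)] L2_tendsto_norm[OF u(3)] by (auto intro: LIMSEQ_unique)
qed

lemma is_fourier_L2_fourier:
  assumes "integrable lebesgue u" "u \<in> L2" shows "is_fourier_L2 u (fourier u)"
  unfolding is_fourier_L2_def L2_tendsto_def
  using assms Plancherel(1)[OF assms] by (intro exI[of _ "\<lambda>k. u"]) simp

lemma is_fourier_L2_diff:
  assumes "is_fourier_L2 f g" "is_fourier_L2 f' g'"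
  shows "is_fourier_L2 (\<lambda>x. f x - f' x) (\<lambda>x. g x - g' x)"
proof -
  obtain u where u: "\<And>k. integrable lebesgue (u k)" "L2_tendsto u f" "L2_tendsto (\<lambda>k. fourier (u k)) g"
    using assms(1) by (auto simp: is_fourier_L2_def)
  obtain v where v: "\<And>k. integrable lebesgue (v k)" "L2_tendsto v f'" "L2_tendsto (\<lambda>k. fourier (v k)) g'"
    using assms(2) by (auto simp: is_fourier_L2_def)
  have "L2_tendsto (\<lambda>k. fourier (\<lambda>x. u k x - v k x)) (\<lambda>x. g x - g' x)"
    using L2_tendsto_diff[OF u(3) v(3)] by (simp add: fourier_diff[OF u(1) v(1)])
  then show ?thesis
    unfolding is_fourier_L2_def using u(1) v(1) L2_tendsto_diff[OF u(2) v(2)]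
    by (intro exI[of _ "\<lambda>k x. u k x - v k x"]) simp
qed

lemma is_fourier_L2_zero: "is_fourier_L2 (\<lambda>x. 0) (\<lambda>x. 0)"
  using is_fourier_L2_fourier[of "\<lambda>x. 0"] by (simp add: fourier_def[abs_def])

lemma is_fourier_L2_add:
  assumes "is_fourier_L2 f g" "is_fourier_L2 f' g'"
  shows "is_fourier_L2 (\<lambda>x. f x + f' x) (\<lambda>x. g x + g' x)"
  using is_fourier_L2_diff[OF assms(1) is_fourier_L2_diff[OF is_fourier_L2_zero assms(2)]] by simp

lemma is_fourier_L2_sum:
  assumes "\<And>i. i \<in> I \<Longrightarrow> is_fourier_L2 (f i) (g i)"
  shows "is_fourier_L2 (\<lambda>x. \<Sum>i\<in>I. f i x) (\<lambda>x. \<Sum>i\<in>I. g i x)"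
  using assms
  by (induction I rule: infinite_finite_induct) (auto intro: is_fourier_L2_add is_fourier_L2_zero)

lemma L2_tendsto_cong_AE:
  fixes f f' :: "'a::euclidean_space \<Rightarrow> 'b::euclidean_space"
  assumes u: "L2_tendsto u f" and f': "f' \<in> borel_measurable lebesgue" "AE x in lebesgue. f x = f' x"
  shows "L2_tendsto u f'"
proof -
  note uf = L2_tendstoD[OF u]
  have "f' \<in> L2" by (rule L2_cong_AE[OF f'(1) uf(2)]) (use f'(2) in eventually_elim, simp)
  moreover have "L2_norm (\<lambda>x. u k x - f' x) = L2_norm (\<lambda>x. u k x - f x)" for k
    by (rule L2_norm_cong_AE)
      (use L2_measurable[OF L2_diff[OF uf(1) uf(2)]] L2_measurable[OF L2_diff[OF uf(1) \<open>f' \<in> L2\<close>]] f'(2) in auto)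
  ultimately show ?thesis
    unfolding L2_tendsto_def using uf by simp
qed

lemma is_fourier_L2_cong_AE:
  assumes "is_fourier_L2 f g" "g' \<in> borel_measurable lebesgue" "AE x in lebesgue. g x = g' x"
  shows "is_fourier_L2 f g'"
  using assms L2_tendsto_cong_AE unfolding is_fourier_L2_def by blast

lemma is_fourier_L2_unique:
  assumes "is_fourier_L2 f g" "is_fourier_L2 f g'"
  shows "AE \<xi> in lebesgue. g \<xi> = g' \<xi>"
proof -
  have "is_fourier_L2 (\<lambda>x. 0) (\<lambda>\<xi>. g \<xi> - g' \<xi>)"
    using is_fourier_L2_diff[OF assms] by simp
  then have "AE \<xi> in lebesgue. g \<xi> - g' \<xi> = 0"
    by (intro L2_norm_eq_0D is_fourier_L2_in_L2) (use is_fourier_L2_norm in force)+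
  then show ?thesis by simp
qed

text \<open>The difference has transform 0, so by the isometry its norm is 0. Through this lemma a
  decomposition of a multiplier becomes one of the operator.\<close>

lemma is_fourier_L2_inj:
  assumes "is_fourier_L2 f g" "is_fourier_L2 f' g"
  shows "AE x in lebesgue. f x = f' x"
proof -
  have *: "is_fourier_L2 (\<lambda>x. f x - f' x) (\<lambda>\<xi>. 0)"
    using is_fourier_L2_diff[OF assms] by simp
  have "AE x in lebesgue. f x - f' x = 0"
    by (rule L2_norm_eq_0D[OF is_fourier_L2_in_L2(1)[OF *]]) (use is_fourier_L2_norm[OF *] in simp)
  then show ?thesis by simp
qed

text \<open>The isometry carries the Cauchy property of the approximants over to their transforms,
  and completeness supplies the limit.\<close>

lemma is_fourier_L2_exists:
  assumes f: "f \<in> L2" obtains g where "is_fourier_L2 f g"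
proof -
  obtain v where v: "\<And>k. v k \<in> Cc" "L2_tendsto v f"
    using Cc_dense[OF f] by blast
  note vi = Cc_integrable[OF v(1)] Cc_L2[OF v(1)]
  have iso: "L2_norm (\<lambda>\<xi>. fourier (v m) \<xi> - fourier (v n) \<xi>) = L2_norm (\<lambda>x. v m x - v n x)" for m n
    using Plancherel(2)[of "\<lambda>x. v m x - v n x"] L2_diff[OF vi(2) vi(2)] vi(1)
    by (simp add: fourier_diff)
  obtain g where "L2_tendsto (\<lambda>k. fourier (v k)) g"
  proof (rule L2_complete)
    show "fourier (v k) \<in> L2" for k by (rule Plancherel_Cc(1)[OF v(1)])
    fix e :: real assume "e > 0"
    then have "\<forall>\<^sub>F k in sequentially. L2_norm (\<lambda>x. v k x - f x) < e/2"
      by (intro order_tendstoD[OF L2_tendstoD(3)[OF v(2)]]) simp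
    then obtain N where N: "\<And>k. k \<ge> N \<Longrightarrow> L2_norm (\<lambda>x. v k x - f x) < e/2"
      by (auto simp: eventually_sequentially)
    have "L2_norm (\<lambda>x. v m x - v n x) \<le> e" if "m \<ge> N" "n \<ge> N" for m n
      using L2_norm_triangle_diff[OF vi(2)[of m] f vi(2)[of n]] N[OF that(1)] N[OF that(2)]
        L2_norm_minus_commute[of f "v n"] by linarith
    then show "\<exists>N. \<forall>m\<ge>N. \<forall>n\<ge>N. L2_norm (\<lambda>\<xi>. fourier (v m) \<xi> - fourier (v n) \<xi>) \<le> e"
      unfolding iso by blast
  qed
  then have "is_fourier_L2 f g"
    unfolding is_fourier_L2_def using v vi by blast
  then show ?thesis by (rule that)
qed

text \<open>The relation offers only some integrable approximants, but the multiplication formula is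
  available for \<open>Cc\<close>. Any approximation from \<open>Cc\<close> will do, since the
  isometry for \<open>v k - f\<close> forces its transforms to tend to \<open>g\<close>.\<close>

lemma is_fourier_L2_Cc:
  assumes "is_fourier_L2 f g"
  obtains v where "\<And>k. v k \<in> Cc" "L2_tendsto v f" "L2_tendsto (\<lambda>k. fourier (v k)) g"
proof -
  note fg = is_fourier_L2_in_L2[OF assms]
  obtain v where v: "\<And>k. v k \<in> Cc" "L2_tendsto v f"
    using Cc_dense[OF fg(1)] by blast
  have "L2_norm (\<lambda>\<xi>. fourier (v k) \<xi> - g \<xi>) = L2_norm (\<lambda>x. v k x - f x)" for k
    by (intro is_fourier_L2_norm is_fourier_L2_diff is_fourier_L2_fourier assms Cc_integrable Cc_L2 v)
  then have "L2_tendsto (\<lambda>k. fourier (v k)) g"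
    unfolding L2_tendsto_def using fg Plancherel_Cc(1)[OF v(1)] L2_tendstoD(3)[OF v(2)] by simp
  then show ?thesis by (rule that[OF v])
qed

section \<open>The multiplication formula on \<open>L2\<close> and surjectivity\<close>

lemma
  fixes f g :: "'a::euclidean_space \<Rightarrow> complex"
  assumes "f \<in> L2" "g \<in> L2"
  shows L2_prod_integrable: "integrable lebesgue (\<lambda>x. f x * g x)"
    and L2_prod_le: "cmod (LINT x|lebesgue. f x * g x) \<le> L2_norm f * L2_norm g"
proof -
  note [measurable] = L2_measurable[OF assms(1)] L2_measurable[OF assms(2)]
  show "integrable lebesgue (\<lambda>x. f x * g x)"
    by (rule Bochner_Integration.integrable_bound[OF L2_mult_integrable[OF assms]]) (auto simp: norm_mult)
  have "cmod (LINT x|lebesgue. f x * g x) \<le> (LINT x|lebesgue. norm (f x * g x))"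
    by (rule integral_norm_bound)
  then show "cmod (LINT x|lebesgue. f x * g x) \<le> L2_norm f * L2_norm g"
    using L2_Cauchy_Schwarz[OF assms] by (simp add: norm_mult)
qed

lemma L2_tendsto_integral_mult:
  fixes f g :: "'a::euclidean_space \<Rightarrow> complex"
  assumes u: "L2_tendsto u f" and v: "L2_tendsto v g"
  shows "(\<lambda>k. LINT x|lebesgue. u k x * v k x) \<longlonglongrightarrow> (LINT x|lebesgue. f x * g x)"
proof (rule LIM_zero_cancel, rule Lim_null_comparison[OF always_eventually], intro allI)
  note L = L2_tendstoD(1,2)[OF u] L2_tendstoD(1,2)[OF v]
  let ?b = "\<lambda>k. L2_norm (\<lambda>x. u k x - f x) * L2_norm (v k) + L2_norm f * L2_norm (\<lambda>x. v k x - g x)"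
  have "?b \<longlonglongrightarrow> 0 * L2_norm g + L2_norm f * 0"
    by (intro tendsto_intros L2_tendstoD(3)[OF u] L2_tendstoD(3)[OF v] L2_tendsto_norm v)
  then show "?b \<longlonglongrightarrow> 0" by simp
  fix k
  have "(LINT x|lebesgue. u k x * v k x) - (LINT x|lebesgue. f x * g x)
      = (LINT x|lebesgue. u k x * v k x - f x * g x)"
    by (intro Bochner_Integration.integral_diff[symmetric] L2_prod_integrable L)
  also have "\<dots> = (LINT x|lebesgue. (u k x - f x) * v k x + f x * (v k x - g x))"
    by (simp add: algebra_simps)
  also have "\<dots> = (LINT x|lebesgue. (u k x - f x) * v k x) + (LINT x|lebesgue. f x * (v k x - g x))"
    by (intro Bochner_Integration.integral_add L2_prod_integrable L L2_diff)
  also have "norm \<dots> \<le> ?b k"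
    by (intro norm_triangle_le add_mono L2_prod_le L L2_diff)
  finally show "norm ((LINT x|lebesgue. u k x * v k x) - (LINT x|lebesgue. f x * g x)) \<le> ?b k" .
qed

text \<open>Both sides are continuous in the \<open>L2\<close> norm, so the formula extends from
  \<open>Cc\<close> by density.\<close>

lemma is_fourier_L2_mult:
  assumes "is_fourier_L2 f g" "is_fourier_L2 f' g'"
  shows "(LINT x|lebesgue. g x * f' x) = (LINT x|lebesgue. f x * g' x)"
proof -
  obtain u where u: "\<And>k. u k \<in> Cc" "L2_tendsto u f" "L2_tendsto (\<lambda>k. fourier (u k)) g"
    using is_fourier_L2_Cc[OF assms(1)] by blast
  obtain v where v: "\<And>k. v k \<in> Cc" "L2_tendsto v f'" "L2_tendsto (\<lambda>k. fourier (v k)) g'"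
    using is_fourier_L2_Cc[OF assms(2)] by blast
  have "(\<lambda>k. LINT x|lebesgue. fourier (u k) x * v k x) \<longlonglongrightarrow> (LINT x|lebesgue. g x * f' x)"
    by (rule L2_tendsto_integral_mult[OF u(3) v(2)])
  moreover have "(\<lambda>k. LINT x|lebesgue. fourier (u k) x * v k x) \<longlonglongrightarrow> (LINT x|lebesgue. f x * g' x)"
    unfolding fourier_mult_Cc[OF u(1) v(1)] by (rule L2_tendsto_integral_mult[OF u(2) v(3)])
  ultimately show ?thesis by (rule LIMSEQ_unique)
qed

lemma L2_cnj:
  assumes "f \<in> L2" shows "(\<lambda>x. cnj (f x)) \<in> L2"
proof -
  note [measurable] = L2_measurable[OF assms]
  show ?thesis by (rule L2_I) (use L2_integrable[OF assms] in auto)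
qed

lemma L2_norm_cnj: "L2_norm (\<lambda>x. cnj (f x)) = L2_norm f"
  by (simp add: L2_norm_def)

lemma L2_norm_diff_square:
  fixes f g :: "'a::euclidean_space \<Rightarrow> complex"
  assumes f: "f \<in> L2" and g: "g \<in> L2"
  shows "(L2_norm (\<lambda>x. f x - g x))\<^sup>2 = (L2_norm f)\<^sup>2 + (L2_norm g)\<^sup>2 - 2 * Re (LINT x|lebesgue. f x * cnj (g x))"
proof -
  have "(cmod (f x - g x))\<^sup>2 = (cmod (f x))\<^sup>2 + (cmod (g x))\<^sup>2 - 2 * Re (f x * cnj (g x))" for x
    by (simp add: cmod_power2 algebra_simps power2_diff)
  then show ?thesis
    using L2_integrable[OF f] L2_integrable[OF g] L2_prod_integrable[OF f L2_cnj[OF g]]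
    by (simp add: L2_norm_square del: times_complex.sel)
qed

text \<open>With \<open>h = cnj (F (cnj g))\<close> the multiplication formula gives \<open>\<langle>F h, g\<rangle> = \<parallel>g\<parallel>\<^sup>2\<close>, and since \<open>F\<close> is
  an isometry this forces \<open>F h = g\<close>.\<close>

lemma is_fourier_L2_surj:
  assumes g: "g \<in> L2" obtains f where "is_fourier_L2 f g"
proof -
  obtain k where k: "is_fourier_L2 (\<lambda>x. cnj (g x)) k"
    using is_fourier_L2_exists[OF L2_cnj[OF g]] by blast
  define h where "h x = cnj (k x)" for x
  have h: "h \<in> L2" unfolding h_def[abs_def] by (rule L2_cnj[OF is_fourier_L2_in_L2(2)[OF k]])
  obtain G where G: "is_fourier_L2 h G" using is_fourier_L2_exists[OF h] by blast
  have k_norm: "L2_norm k = L2_norm g"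
    using is_fourier_L2_norm[OF k] by (simp add: L2_norm_cnj)
  have G_norm: "L2_norm G = L2_norm g"
    using is_fourier_L2_norm[OF G] k_norm by (simp add: h_def[abs_def] L2_norm_cnj)
  have "(LINT x|lebesgue. G x * cnj (g x)) = (LINT x|lebesgue. h x * k x)"
    by (rule is_fourier_L2_mult[OF G k])
  also have "\<dots> = (LINT x|lebesgue. of_real ((cmod (k x))\<^sup>2))"
    by (simp only: h_def complex_norm_square mult.commute)
  also have "\<dots> = of_real ((L2_norm g)\<^sup>2)"
    by (simp only: integral_complex_of_real L2_norm_square[symmetric] k_norm)
  finally have "(L2_norm (\<lambda>x. G x - g x))\<^sup>2 = 0"
    unfolding L2_norm_diff_square[OF is_fourier_L2_in_L2(2)[OF G] g] by (simp only: G_norm Re_complex_of_real)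
  then have "AE x in lebesgue. G x - g x = 0"
    by (intro L2_norm_eq_0D L2_diff is_fourier_L2_in_L2(2)[OF G] g) simp
  then have "is_fourier_L2 h g"
    by (intro is_fourier_L2_cong_AE[OF G L2_measurable[OF g]]) simp
  then show ?thesis by (rule that)
qed

lemma is_fourier_L2_fourier_L2:
  assumes "f \<in> L2" shows "is_fourier_L2 f (fourier_L2 f)"
  unfolding fourier_L2_def is_fourier_L2_def[symmetric]
  using is_fourier_L2_exists[OF assms] by (metis someI)

text \<open>Surjectivity makes the choice in \<open>inv_fourier_L2\<close> meaningful. The maximal
  inequality sees the chosen functions only through this fact and its counterpart for
  \<open>fourier_L2\<close>.\<close>

lemma is_fourier_L2_inv_fourier_L2:
  assumes g: "g \<in> L2" shows "is_fourier_L2 (inv_fourier_L2 g) g"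
proof -
  obtain f where f: "is_fourier_L2 f g" using is_fourier_L2_surj[OF g] by blast
  have fL: "f \<in> L2" by (rule is_fourier_L2_in_L2(1)[OF f])
  have "\<exists>f. f \<in> L2 \<and> (AE \<xi> in lebesgue. fourier_L2 f \<xi> = g \<xi>)"
    using fL is_fourier_L2_unique[OF is_fourier_L2_fourier_L2[OF fL] f] by blast
  then have "inv_fourier_L2 g \<in> L2 \<and> (AE \<xi> in lebesgue. fourier_L2 (inv_fourier_L2 g) \<xi> = g \<xi>)"
    unfolding inv_fourier_L2_def by (rule someI_ex)
  then show ?thesis
    using is_fourier_L2_cong_AE[OF is_fourier_L2_fourier_L2 L2_measurable[OF g]] by blast
qed

section \<open>Dyadic decomposition and the maximal inequality\<close>

text \<open>\<open>n div 2^i * 2^i\<close> is n with its lowest i binary digits cleared. Restoring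
  digit i lengthens the initial segment by one aligned block of length \<open>2^i\<close> if that
  digit is 1, and leaves it unchanged otherwise.\<close>

lemma sum_lessThan_dyadic:
  fixes h :: "nat \<Rightarrow> 'v::comm_monoid_add"
  assumes "n < 2^L"
  shows "sum h {..<n} = (\<Sum>i<L. if odd (n div 2^i)
           then sum h {(n div 2^i - 1) * 2^i ..< (n div 2^i - 1) * 2^i + 2^i} else 0)"
proof -
  let ?t = "\<lambda>i. if odd (n div 2^i)
    then sum h {(n div 2^i - 1) * 2^i ..< (n div 2^i - 1) * 2^i + 2^i} else 0"
  \<comment> \<open>For odd q = \<open>n div 2^i\<close> the new block starts at (q - 1) * 2^i.
    Oddness gives q > 0, so the truncated subtraction is harmless.\<close>
  have step: "sum h {..< n div 2^i * 2^i} = sum h {..< n div 2^(Suc i) * 2^(Suc i)} + ?t i" for i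
  proof -
    define q where "q = n div 2^i"
    have q2: "n div 2^(Suc i) = q div 2" unfolding q_def power_Suc2 by (rule div_mult2_eq)
    show ?thesis
    proof (cases "odd q")
      case True
      then obtain p where p: "q = Suc (2 * p)" by (auto elim: oddE)
      have "{..<q * 2^i} = {..<2 * p * 2^i} \<union> {2 * p * 2^i ..< 2 * p * 2^i + 2^i}"
        by (auto simp: p)
      moreover have "{..<2 * p * 2^i} \<inter> {2 * p * 2^i ..< 2 * p * 2^i + 2^i} = {}"
        by auto
      ultimately have "sum h {..<q * 2^i} = sum h {..<2 * p * 2^i} + sum h {2 * p * 2^i ..< 2 * p * 2^i + 2^i}"
        by (simp only: sum.union_disjoint finite_lessThan finite_atLeastLessThan)
      then show ?thesis unfolding q2 using True p by (simp add: q_def[symmetric] mult_ac)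
    next
      case False
      then have "q div 2 * 2 = q" by simp
      then have "q div 2 * 2^(Suc i) = q * 2^i" by (metis mult.assoc power_Suc)
      then show ?thesis unfolding q2 using False by (simp only: q_def[symmetric] if_False add_0_right)
    qed
  qed
  have "sum h {..<n} = sum h {..< n div 2^L * 2^L} + (\<Sum>i<L. ?t i)" for L
  proof (induction L)
    case (Suc L)
    then show ?case by (subst Suc.IH, subst step) (simp add: add_ac)
  qed simp
  from this[of L] show ?thesis using assms by simp
qed

text \<open>The expansion in each variable uses at most one block per pair of scales, and its norm
  is one coordinate of the l2 norm over all blocks of that pair. The right side depends on
  \<open>l1\<close> and \<open>l2\<close> but not on \<open>n1\<close> and \<open>n2\<close>, as a
  majorant of the maximum must.\<close>

lemma norm_double_sum_dyadic_le:
  fixes g :: "nat \<Rightarrow> nat \<Rightarrow> 'v::real_normed_vector"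
  assumes n: "n1 < 2^l1" "n2 < 2^l2"
  shows "norm (\<Sum>j1<n1. \<Sum>j2<n2. g j1 j2) \<le> (\<Sum>i1<l1. \<Sum>i2<l2.
    L2_set (\<lambda>(k1, k2). norm (\<Sum>j1=k1*2^i1..<k1*2^i1+2^i1. \<Sum>j2=k2*2^i2..<k2*2^i2+2^i2. g j1 j2))
      ({..<2^l1} \<times> {..<2^l2}))" (is "_ \<le> (\<Sum>i1<l1. \<Sum>i2<l2. ?S i1 i2)")
proof -
  let ?D = "\<lambda>i k::nat. {k*2^i..<k*2^i+2^i}"
  let ?k = "\<lambda>n i. n div 2^i - 1 :: nat"
  let ?t = "\<lambda>i1 i2. if odd (n1 div 2^i1) \<and> odd (n2 div 2^i2)
      then \<Sum>j1\<in>?D i1 (?k n1 i1). \<Sum>j2\<in>?D i2 (?k n2 i2). g j1 j2 else 0"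
  have "(\<Sum>j1<n1. \<Sum>j2<n2. g j1 j2) = (\<Sum>i1<l1. if odd (n1 div 2^i1) then \<Sum>j1\<in>?D i1 (?k n1 i1). \<Sum>j2<n2. g j1 j2 else 0)"
    by (rule sum_lessThan_dyadic[OF n(1)])
  also have "\<dots> = (\<Sum>i1<l1. \<Sum>i2<l2. ?t i1 i2)"
  proof (rule sum.cong[OF refl])
    fix i1
    have "(\<Sum>j1\<in>A. \<Sum>j2<n2. g j1 j2) = (\<Sum>i2<l2. if odd (n2 div 2^i2) then \<Sum>j1\<in>A. \<Sum>j2\<in>?D i2 (?k n2 i2). g j1 j2 else 0)" for A
    proof -
      have "(\<Sum>j1\<in>A. if odd (n2 div 2^i2) then \<Sum>j2\<in>?D i2 (?k n2 i2). g j1 j2 else 0)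
          = (if odd (n2 div 2^i2) then \<Sum>j1\<in>A. \<Sum>j2\<in>?D i2 (?k n2 i2). g j1 j2 else 0)" for i2
        by (cases "odd (n2 div 2^i2)") (simp_all only: if_True if_False simp_thms sum.neutral_const)
      then show ?thesis
        unfolding sum_lessThan_dyadic[OF n(2)] by (subst sum.swap) (simp only:)
    qed
    note split2 = this
    show "(if odd (n1 div 2^i1) then \<Sum>j1\<in>?D i1 (?k n1 i1). \<Sum>j2<n2. g j1 j2 else 0) = (\<Sum>i2<l2. ?t i1 i2)"
      by (cases "odd (n1 div 2^i1)") (simp_all only: split2 if_True if_False simp_thms sum.neutral_const)
  qed
  finally have eq: "(\<Sum>j1<n1. \<Sum>j2<n2. g j1 j2) = (\<Sum>i1<l1. \<Sum>i2<l2. ?t i1 i2)" .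
  show ?thesis
    unfolding eq
  proof (intro sum_norm_le)
    fix i1 i2
    \<comment> \<open>A generous range of block indices, the same for all scales. It costs nothing
      because the later bound is uniform in the number of blocks.\<close>
    have k: "?k n1 i1 < 2^l1" "?k n2 i2 < 2^l2"
      by (rule le_less_trans[OF order_trans[OF diff_le_self div_le_dividend] n(1)],
          rule le_less_trans[OF order_trans[OF diff_le_self div_le_dividend] n(2)])
    have "(\<lambda>(k1, k2). norm (\<Sum>j1\<in>?D i1 k1. \<Sum>j2\<in>?D i2 k2. g j1 j2)) (?k n1 i1, ?k n2 i2) \<le> ?S i1 i2"
      by (rule member_le_L2_set) (use k in simp_all)
    then have "norm (\<Sum>j1\<in>?D i1 (?k n1 i1). \<Sum>j2\<in>?D i2 (?k n2 i2). g j1 j2) \<le> ?S i1 i2"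
      by (simp only: prod.case)
    moreover have "0 \<le> ?S i1 i2" by (rule L2_set_nonneg)
    ultimately show "norm (?t i1 i2) \<le> ?S i1 i2"
      by (cases "odd (n1 div 2^i1) \<and> odd (n2 div 2^i2)") (simp_all only: if_True if_False norm_zero simp_thms)
  qed
qed

section \<open>Mixed differences and the variation bound\<close>

text \<open>The boundary cases are separate because truncated subtraction would make the differences
  at index 0 vanish instead of reading the value 0 at index -1.\<close>

definition full_diff :: "(nat \<Rightarrow> nat \<Rightarrow> 'a::ab_group_add) \<Rightarrow> nat \<Rightarrow> nat \<Rightarrow> 'a" where
  "full_diff a j1 j2 = (if j1 = 0 then if j2 = 0 then a 0 0 else diff2 a 0 j2
     else if j2 = 0 then diff1 a j1 0 else diff12 a j1 j2)"

lemma sum_full_diff: "(\<Sum>j1<Suc n1. \<Sum>j2<Suc n2. full_diff a j1 j2) = a n1 n2"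
proof -
  have inner: "(\<Sum>j2<Suc n2. full_diff a j1 j2) = (if j1 = 0 then a 0 n2 else a j1 n2 - a (j1 - 1) n2)" for j1
    by (induction n2) (simp_all add: full_diff_def diff1_def diff2_def diff12_def)
  show ?thesis
    unfolding inner by (induction n1) simp_all
qed

text \<open>In \<open>ereal\<close> a nonnegative infinite sum is the supremum of its finite partial
  sums, and a divergent one is infinite rather than a default value. The argument takes from the
  hypotheses just these finite bounds.\<close>

lemma finite_sum_le_of_infsum_ereal:
  fixes f :: "'i \<Rightarrow> real"
  assumes "finite F" "F \<subseteq> A" "\<And>x. 0 \<le> f x" "(\<Sum>\<^sub>\<infinity>x\<in>A. ereal (f x)) \<le> ereal B"
  shows "sum f F \<le> B"
proof -
  have "ereal (sum f F) = (\<Sum>x\<in>F. ereal (f x))" by simp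
  also have "\<dots> \<le> (\<Sum>\<^sub>\<infinity>x\<in>A. ereal (f x))"
    using assms by (subst nonneg_infsum_complete) (auto intro: SUP_upper)
  finally have "ereal (sum f F) \<le> ereal B" using assms(4) by (rule order_trans)
  then show ?thesis by simp
qed

lemma sum_norm_full_diff_le:
  fixes a :: "nat \<Rightarrow> nat \<Rightarrow> complex"
  assumes 12: "(\<Sum>\<^sub>\<infinity>(n1, n2)\<in>{1..} \<times> {1..}. ereal (cmod (diff12 a n1 n2))) \<le> ereal B"
    and 1: "(\<Sum>\<^sub>\<infinity>n1\<in>{1..}. ereal (cmod (diff1 a n1 0))) \<le> ereal B"
    and 2: "(\<Sum>\<^sub>\<infinity>n2\<in>{1..}. ereal (cmod (diff2 a 0 n2))) \<le> ereal B"
    and 0: "cmod (a 0 0) \<le> B"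
  shows "(\<Sum>j1<n1. \<Sum>j2<n2. cmod (full_diff a j1 j2)) \<le> 4 * B"
proof -
  let ?f = "\<lambda>j1 j2. cmod (full_diff a j1 j2)"
  \<comment> \<open>Enlarging both ranges by one guarantees that row 0 and column 0 are present and
    can be split off.\<close>
  have "(\<Sum>j1<n1. \<Sum>j2<n2. ?f j1 j2) \<le> (\<Sum>j1<Suc n1. \<Sum>j2<Suc n2. ?f j1 j2)"
    by (intro order_trans[OF sum_mono[OF sum_mono2] sum_mono2] sum_nonneg) auto
  also have "\<dots> = ?f 0 0 + (\<Sum>j2\<in>{1..<Suc n2}. ?f 0 j2)
      + ((\<Sum>j1\<in>{1..<Suc n1}. ?f j1 0) + (\<Sum>j1\<in>{1..<Suc n1}. \<Sum>j2\<in>{1..<Suc n2}. ?f j1 j2))"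
    by (simp add: lessThan_atLeast0 sum.atLeast_Suc_lessThan[of 0] sum.distrib)
  also have "(\<Sum>j2\<in>{1..<Suc n2}. ?f 0 j2) = (\<Sum>j2\<in>{1..<Suc n2}. cmod (diff2 a 0 j2))"
    by (intro sum.cong) (auto simp: full_diff_def)
  also have "\<dots> \<le> B"
    by (rule finite_sum_le_of_infsum_ereal[OF _ _ _ 2]) auto
  also have "(\<Sum>j1\<in>{1..<Suc n1}. ?f j1 0) = (\<Sum>j1\<in>{1..<Suc n1}. cmod (diff1 a j1 0))"
    by (intro sum.cong) (auto simp: full_diff_def)
  also have "\<dots> \<le> B"
    by (rule finite_sum_le_of_infsum_ereal[OF _ _ _ 1]) auto
  also have "(\<Sum>j1\<in>{1..<Suc n1}. \<Sum>j2\<in>{1..<Suc n2}. ?f j1 j2)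
      = (\<Sum>(j1, j2)\<in>{1..<Suc n1} \<times> {1..<Suc n2}. cmod (diff12 a j1 j2))"
    unfolding sum.cartesian_product by (intro sum.cong) (auto simp: full_diff_def)
  also have "\<dots> \<le> B"
    using 12 by (intro finite_sum_le_of_infsum_ereal[where A="{1..} \<times> {1..}"]) (auto simp: case_prod_unfold)
  also have "?f 0 0 \<le> B" using 0 by (simp add: full_diff_def)
  finally show ?thesis by simp
qed

text \<open>The blocks of one pair of scales tile a rectangle, so after l2 is bounded by l1 and the
  triangle inequality is applied, every \<open>cmod (b j1 j2)\<close> appears exactly once. The
  bound is therefore independent of scales and block numbers.\<close>

lemma L2_set_dyadic_blocks_le:
  fixes b :: "nat \<Rightarrow> nat \<Rightarrow> complex"
  assumes "\<And>n1 n2. (\<Sum>j1<n1. \<Sum>j2<n2. cmod (b j1 j2)) \<le> A"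
  shows "L2_set (\<lambda>(k1, k2). cmod (\<Sum>j1=k1*2^i1..<k1*2^i1+2^i1. \<Sum>j2=k2*2^i2..<k2*2^i2+2^i2. b j1 j2))
      ({..<K1} \<times> {..<K2}) \<le> A"
proof -
  let ?D = "\<lambda>i k::nat. {k*2^i..<k*2^i+2^i}"
  have "L2_set (\<lambda>(k1, k2). cmod (\<Sum>j1\<in>?D i1 k1. \<Sum>j2\<in>?D i2 k2. b j1 j2)) ({..<K1} \<times> {..<K2})
      \<le> (\<Sum>(k1, k2)\<in>{..<K1} \<times> {..<K2}. cmod (\<Sum>j1\<in>?D i1 k1. \<Sum>j2\<in>?D i2 k2. b j1 j2))"
    by (rule L2_set_le_sum) auto
  also have "\<dots> = (\<Sum>k1<K1. \<Sum>k2<K2. cmod (\<Sum>j1\<in>?D i1 k1. \<Sum>j2\<in>?D i2 k2. b j1 j2))"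
    by (simp add: sum.cartesian_product)
  also have "\<dots> \<le> (\<Sum>k1<K1. \<Sum>k2<K2. \<Sum>j1\<in>?D i1 k1. \<Sum>j2\<in>?D i2 k2. cmod (b j1 j2))"
    by (intro sum_mono sum_norm_le order_refl)
  also have "\<dots> = (\<Sum>k1<K1. \<Sum>j1\<in>?D i1 k1. \<Sum>k2<K2. \<Sum>j2\<in>?D i2 k2. cmod (b j1 j2))"
    by (intro sum.cong refl sum.swap)
  also have "\<dots> = (\<Sum>j1<K1*2^i1. \<Sum>j2<K2*2^i2. cmod (b j1 j2))"
    by (simp only: sum.nat_group)
  also have "\<dots> \<le> A" by (rule assms)
  finally show ?thesis .
qed

section \<open>Square functions and the maximal function\<close>

text \<open>The square of an l2 norm is a finite sum, which commutes with the integral. Plancherel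
  applies to each term, and on the frequency side the sum is recombined pointwise into the l2 norm
  of the multipliers.\<close>

lemma is_fourier_L2_square_function:
  fixes F :: "'a::euclidean_space \<Rightarrow> complex"
  assumes "finite K" and T: "\<And>k. k \<in> K \<Longrightarrow> is_fourier_L2 (T k) (\<lambda>\<xi>. c k \<xi> * F \<xi>)"
    and F: "F \<in> L2" and "0 \<le> A" and c: "\<And>\<xi>. L2_set (\<lambda>k. cmod (c k \<xi>)) K \<le> A"
  shows "(\<lambda>x. L2_set (\<lambda>k. cmod (T k x)) K) \<in> L2"
    and "L2_norm (\<lambda>x. L2_set (\<lambda>k. cmod (T k x)) K) \<le> A * L2_norm F"
proof -
  note TL = is_fourier_L2_in_L2[OF T]
  have sq: "(norm (L2_set (\<lambda>k. cmod (T k x)) K))\<^sup>2 = (\<Sum>k\<in>K. (cmod (T k x))\<^sup>2)" for x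
    by (simp add: L2_set_def sum_nonneg)
  have Tm: "(\<lambda>x. \<Sum>k\<in>K. (cmod (T k x))\<^sup>2) \<in> borel_measurable lebesgue"
    using L2_measurable[OF TL(1)] by measurable
  have Ti: "integrable lebesgue (\<lambda>x. \<Sum>k\<in>K. (cmod (T k x))\<^sup>2)"
    by (intro Bochner_Integration.integrable_sum L2_integrable TL(1))
  show "(\<lambda>x. L2_set (\<lambda>k. cmod (T k x)) K) \<in> L2"
    by (rule L2_I, unfold sq) (use Tm in \<open>simp add: L2_set_def\<close>, rule Ti)
  have "(L2_norm (\<lambda>x. L2_set (\<lambda>k. cmod (T k x)) K))\<^sup>2 = (\<Sum>k\<in>K. (L2_norm (T k))\<^sup>2)"
    unfolding L2_norm_square sq by (intro Bochner_Integration.integral_sum L2_integrable TL(1))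
  also have "\<dots> = (\<Sum>k\<in>K. (L2_norm (\<lambda>\<xi>. c k \<xi> * F \<xi>))\<^sup>2)"
    by (intro sum.cong refl) (simp add: is_fourier_L2_norm[OF T])
  also have "\<dots> = (LINT \<xi>|lebesgue. (\<Sum>k\<in>K. (cmod (c k \<xi> * F \<xi>))\<^sup>2))"
    unfolding L2_norm_square by (intro Bochner_Integration.integral_sum[symmetric] L2_integrable TL(2))
  also have "\<dots> \<le> (LINT \<xi>|lebesgue. A\<^sup>2 * (cmod (F \<xi>))\<^sup>2)"
  proof (rule integral_mono)
    show "integrable lebesgue (\<lambda>\<xi>. \<Sum>k\<in>K. (cmod (c k \<xi> * F \<xi>))\<^sup>2)"
      by (intro Bochner_Integration.integrable_sum L2_integrable TL(2))
    show "integrable lebesgue (\<lambda>\<xi>. A\<^sup>2 * (cmod (F \<xi>))\<^sup>2)" using L2_integrable[OF F] by simp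
    fix \<xi>
    have "(\<Sum>k\<in>K. (cmod (c k \<xi> * F \<xi>))\<^sup>2) = (L2_set (\<lambda>k. cmod (c k \<xi>)) K)\<^sup>2 * (cmod (F \<xi>))\<^sup>2"
      by (simp add: norm_mult power_mult_distrib sum_distrib_right L2_set_def sum_nonneg)
    also have "\<dots> \<le> A\<^sup>2 * (cmod (F \<xi>))\<^sup>2"
      by (intro mult_right_mono power_mono c L2_set_nonneg) simp
    finally show "(\<Sum>k\<in>K. (cmod (c k \<xi> * F \<xi>))\<^sup>2) \<le> A\<^sup>2 * (cmod (F \<xi>))\<^sup>2" .
  qed
  also have "\<dots> = (A * L2_norm F)\<^sup>2"
    by (simp add: power_mult_distrib L2_norm_square)
  finally show "L2_norm (\<lambda>x. L2_set (\<lambda>k. cmod (T k x)) K) \<le> A * L2_norm F"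
    using \<open>0 \<le> A\<close> by (simp add: power2_le_iff_abs_le)
qed

lemma L2_bounded_mult:
  fixes b F :: "'a::euclidean_space \<Rightarrow> complex"
  assumes b: "b \<in> borel_measurable lebesgue" "\<And>\<xi>. cmod (b \<xi>) \<le> A" and F: "F \<in> L2"
  shows "(\<lambda>\<xi>. b \<xi> * F \<xi>) \<in> L2"
proof -
  note [measurable] = b(1) L2_measurable[OF F]
  have "0 \<le> A" using b(2)[of undefined] norm_ge_zero order_trans by blast
  show ?thesis
    by (rule L2_dominated(1)[OF _ F _ \<open>0 \<le> A\<close>]) (use b(2) in \<open>auto simp: norm_mult intro!: mult_right_mono\<close>)
qed

lemma maximal_multiplier_bound:
  fixes m :: "nat \<Rightarrow> nat \<Rightarrow> 'a::euclidean_space \<Rightarrow> complex"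
  assumes m: "\<And>n1 n2. m n1 n2 \<in> borel_measurable lebesgue"
    and A: "\<And>\<xi> n1 n2. (\<Sum>j1<n1. \<Sum>j2<n2. cmod (full_diff (\<lambda>i j. m i j \<xi>) j1 j2)) \<le> A"
    and N: "0 < N1" "N1 < 2^l1" "0 < N2" "N2 < 2^l2" and f: "f \<in> L2"
  defines "M \<equiv> \<lambda>x. SUP n1\<in>{0..<N1}. SUP n2\<in>{0..<N2}.
                 cmod (inv_fourier_L2 (\<lambda>\<xi>. m n1 n2 \<xi> * fourier_L2 f \<xi>) x)"
  shows "M \<in> L2" "L2_norm M \<le> real l1 * real l2 * (A * L2_norm f)"
proof -
  define F where "F = fourier_L2 f"
  define b where "b j1 j2 \<xi> = full_diff (\<lambda>i j. m i j \<xi>) j1 j2" for j1 j2 \<xi>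
  define g where "g j1 j2 = inv_fourier_L2 (\<lambda>\<xi>. b j1 j2 \<xi> * F \<xi>)" for j1 j2
  define u where "u n1 n2 = inv_fourier_L2 (\<lambda>\<xi>. m n1 n2 \<xi> * F \<xi>)" for n1 n2
  define S where "S i1 i2 x = L2_set (\<lambda>k. cmod (\<Sum>j1=fst k*2^i1..<fst k*2^i1+2^i1. \<Sum>j2=snd k*2^i2..<snd k*2^i2+2^i2. g j1 j2 x))
      ({..<2^l1} \<times> {..<2^l2})" for i1 i2 :: nat and x
  have F: "is_fourier_L2 f F" unfolding F_def by (rule is_fourier_L2_fourier_L2[OF f])
  note FL = is_fourier_L2_in_L2(2)[OF F]
  have A0: "0 \<le> A" using A[of 0 0 undefined] by simp
  have b_sum: "(\<Sum>j1<n1. \<Sum>j2<n2. cmod (b j1 j2 \<xi>)) \<le> A" for n1 n2 \<xi>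
    unfolding b_def by (rule A)
  have m_sum: "m n1 n2 \<xi> = (\<Sum>j1<Suc n1. \<Sum>j2<Suc n2. b j1 j2 \<xi>)" for n1 n2 \<xi>
    unfolding b_def by (rule sum_full_diff[symmetric])
  have b_le: "cmod (b j1 j2 \<xi>) \<le> A" for j1 j2 \<xi>
  proof -
    have "cmod (b j1 j2 \<xi>) \<le> (\<Sum>j2<Suc j2. cmod (b j1 j2 \<xi>))"
      by (rule member_le_sum) auto
    also have "\<dots> \<le> (\<Sum>j1<Suc j1. \<Sum>j2<Suc j2. cmod (b j1 j2 \<xi>))"
      by (rule member_le_sum[of j1 _ "\<lambda>j1. \<Sum>j2<Suc j2. cmod (b j1 j2 \<xi>)"]) (simp_all add: sum_nonneg del: sum.lessThan_Suc)
    finally show ?thesis using b_sum order_trans by blast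
  qed
  have m_le: "cmod (m n1 n2 \<xi>) \<le> A" for n1 n2 \<xi>
  proof -
    have "cmod (m n1 n2 \<xi>) \<le> (\<Sum>j1<Suc n1. \<Sum>j2<Suc n2. cmod (b j1 j2 \<xi>))"
      unfolding m_sum by (intro sum_norm_le order_refl)
    also have "\<dots> \<le> A" by (rule b_sum)
    finally show ?thesis .
  qed
  have b_meas: "b j1 j2 \<in> borel_measurable lebesgue" for j1 j2
    unfolding b_def[abs_def] full_diff_def diff1_def diff2_def diff12_def using m by measurable
  have g: "is_fourier_L2 (g j1 j2) (\<lambda>\<xi>. b j1 j2 \<xi> * F \<xi>)" for j1 j2
    unfolding g_def by (intro is_fourier_L2_inv_fourier_L2 L2_bounded_mult[OF b_meas b_le FL])
  have u: "is_fourier_L2 (u n1 n2) (\<lambda>\<xi>. m n1 n2 \<xi> * F \<xi>)" for n1 n2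
    unfolding u_def by (intro is_fourier_L2_inv_fourier_L2 L2_bounded_mult[OF m m_le FL])
  have g_block: "is_fourier_L2 (\<lambda>x. \<Sum>j1\<in>I1. \<Sum>j2\<in>I2. g j1 j2 x) (\<lambda>\<xi>. (\<Sum>j1\<in>I1. \<Sum>j2\<in>I2. b j1 j2 \<xi>) * F \<xi>)" for I1 I2
    unfolding sum_distrib_right by (intro is_fourier_L2_sum g)
  \<comment> \<open>Only almost everywhere, since the inverse transforms on the two sides are chosen
    independently of each other.\<close>
  have u_eq: "AE x in lebesgue. u n1 n2 x = (\<Sum>j1<Suc n1. \<Sum>j2<Suc n2. g j1 j2 x)" for n1 n2
    by (rule is_fourier_L2_inj[OF u]) (unfold m_sum, rule g_block)
  have S: "S i1 i2 \<in> L2" "L2_norm (S i1 i2) \<le> A * L2_norm F" for i1 i2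
  proof -
    have c: "L2_set (\<lambda>k. cmod (\<Sum>j1=fst k*2^i1..<fst k*2^i1+2^i1. \<Sum>j2=snd k*2^i2..<snd k*2^i2+2^i2. b j1 j2 \<xi>))
      ({..<2^l1} \<times> {..<2^l2}) \<le> A" for \<xi>
      using L2_set_dyadic_blocks_le[OF b_sum] by (simp add: case_prod_unfold)
    show "S i1 i2 \<in> L2" "L2_norm (S i1 i2) \<le> A * L2_norm F"
      unfolding S_def[abs_def] by (rule is_fourier_L2_square_function[OF _ g_block FL A0 c], simp)+
  qed
  have M_eq: "M x = (SUP n1\<in>{0..<N1}. SUP n2\<in>{0..<N2}. cmod (u n1 n2 x))" for x
    by (simp add: M_def u_def F_def)
  have M0: "0 \<le> M x" for x
    unfolding M_eq using N by (intro cSUP_upper2[of _ _ 0]) auto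
  \<comment> \<open>Countably many exceptional sets have a null union, so the dyadic estimate can be
    applied for all indices at the same x.\<close>
  have "AE x in lebesgue. \<forall>n1 n2. u n1 n2 x = (\<Sum>j1<Suc n1. \<Sum>j2<Suc n2. g j1 j2 x)"
    using u_eq by (simp add: AE_all_countable)
  then have le: "AE x in lebesgue. norm (M x) \<le> 1 * norm (\<Sum>i1<l1. \<Sum>i2<l2. S i1 i2 x)"
  proof eventually_elim
    case (elim x)
    have "cmod (u n1 n2 x) \<le> (\<Sum>i1<l1. \<Sum>i2<l2. S i1 i2 x)" if "n1 < N1" "n2 < N2" for n1 n2
    proof -
      \<comment> \<open>\<open>m n1 n2\<close> sums over n1 + 1 and n2 + 1 indices; n1 < N1 < 2^l1
        leaves room for the extra one.\<close>
      have "Suc n1 < 2^l1" "Suc n2 < 2^l2" using that N by linarith+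
      then show ?thesis
        using norm_double_sum_dyadic_le[of "Suc n1" l1 "Suc n2" l2 "\<lambda>j1 j2. g j1 j2 x"]
        by (simp only: S_def elim case_prod_unfold)
    qed
    then have "M x \<le> (\<Sum>i1<l1. \<Sum>i2<l2. S i1 i2 x)"
      unfolding M_eq using N by (intro cSUP_least) auto
    then show ?case using M0[of x] by simp
  qed
  have u_meas: "(\<lambda>x. cmod (u n1 n2 x)) \<in> borel_measurable lebesgue" for n1 n2
    using L2_measurable[OF is_fourier_L2_in_L2(1)[OF u]] by measurable
  have M_meas: "M \<in> borel_measurable lebesgue"
    unfolding M_eq[abs_def]
    by (intro borel_measurable_cSUP u_meas) auto
  have SL: "(\<lambda>x. \<Sum>i1<l1. \<Sum>i2<l2. S i1 i2 x) \<in> L2"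
    by (intro L2_sum S)
  show "M \<in> L2" by (rule L2_dominated(1)[OF M_meas SL le]) simp
  have "L2_norm M \<le> L2_norm (\<lambda>x. \<Sum>i1<l1. \<Sum>i2<l2. S i1 i2 x)"
    using L2_dominated(2)[OF M_meas SL le] by simp
  also have "\<dots> \<le> (\<Sum>i1<l1. L2_norm (\<lambda>x. \<Sum>i2<l2. S i1 i2 x))"
    by (intro L2_norm_sum L2_sum S)
  also have "\<dots> \<le> (\<Sum>i1<l1. \<Sum>i2<l2. L2_norm (S i1 i2))"
    by (intro sum_mono L2_norm_sum S)
  also have "\<dots> \<le> (\<Sum>i1<l1. \<Sum>i2<l2. A * L2_norm F)"
    by (intro sum_mono S)
  also have "\<dots> = real l1 * real l2 * (A * L2_norm f)"
    by (simp add: is_fourier_L2_norm[OF F])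
  finally show "L2_norm M \<le> real l1 * real l2 * (A * L2_norm f)" .
qed

text \<open>\<open>L\<close> is the number n + 1 of binary digits of \<open>N\<close>. As N \<ge> 2,
  the extra digit costs ln 2 \<le> ln N, which accounts for the factor 2.\<close>

lemma dyadic_length_le_ln:
  assumes "2 \<le> N"
  obtains L where "N < 2^L" "real L \<le> 2 / ln 2 * ln (real N)"
proof -
  obtain n where n: "2^n \<le> N" "N < 2^(n+1)"
    using ex_power_ivl1[of 2 N] assms by auto
  have "ln (2^n) \<le> ln (real N)"
    using n(1) by (subst ln_le_cancel_iff) (use assms of_nat_mono[OF n(1), where 'a=real] in auto)
  moreover have "ln 2 \<le> ln (real N)" using assms by simp
  ultimately have "real (n+1) * ln 2 \<le> 2 * ln (real N)"
    by (simp add: ln_realpow algebra_simps)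
  then have "real (n+1) \<le> 2 / ln 2 * ln (real N)"
    by (simp add: field_simps)
  then show ?thesis using that n(2) by blast
qed

theorem theorem1:
  "\<exists>C>0. \<forall>(m :: nat \<Rightarrow> nat \<Rightarrow> real^2 \<Rightarrow> complex) (B :: real).
     (\<forall>n1 n2. m n1 n2 \<in> borel_measurable lebesgue) \<longrightarrow>
     (SUP \<xi>. \<Sum>\<^sub>\<infinity>(n1, n2)\<in>{1..} \<times> {1..}. ereal (cmod (diff12 (\<lambda>i j. m i j \<xi>) n1 n2))) \<le> ereal B \<longrightarrow>
     (SUP \<xi>. \<Sum>\<^sub>\<infinity>n1\<in>{1..}. ereal (cmod (diff1 (\<lambda>i j. m i j \<xi>) n1 0))) \<le> ereal B \<longrightarrow>
     (SUP \<xi>. \<Sum>\<^sub>\<infinity>n2\<in>{1..}. ereal (cmod (diff2 (\<lambda>i j. m i j \<xi>) 0 n2))) \<le> ereal B \<longrightarrow>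
     (SUP \<xi>. ereal (cmod (m 0 0 \<xi>))) \<le> ereal B \<longrightarrow>
     (\<forall>N1\<ge>2. \<forall>N2\<ge>2. \<forall>f\<in>L2.
        (let M = (\<lambda>x. SUP n1\<in>{0..<N1}. SUP n2\<in>{0..<N2}.
                        cmod (inv_fourier_L2 (\<lambda>\<xi>. m n1 n2 \<xi> * fourier_L2 f \<xi>) x))
         in M \<in> L2 \<and> L2_norm M \<le> C * B * ln (real N1) * ln (real N2) * L2_norm f))"
proof (intro exI[of _ "16 / (ln 2)\<^sup>2"] conjI allI impI ballI)
  fix m :: "nat \<Rightarrow> nat \<Rightarrow> real^2 \<Rightarrow> complex" and B :: real and N1 N2 :: nat and f :: "real^2 \<Rightarrow> complex"
  assume m: "\<forall>n1 n2. m n1 n2 \<in> borel_measurable lebesgue"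
    and 12: "(SUP \<xi>. \<Sum>\<^sub>\<infinity>(n1, n2)\<in>{1..} \<times> {1..}. ereal (cmod (diff12 (\<lambda>i j. m i j \<xi>) n1 n2))) \<le> ereal B"
    and 1: "(SUP \<xi>. \<Sum>\<^sub>\<infinity>n1\<in>{1..}. ereal (cmod (diff1 (\<lambda>i j. m i j \<xi>) n1 0))) \<le> ereal B"
    and 2: "(SUP \<xi>. \<Sum>\<^sub>\<infinity>n2\<in>{1..}. ereal (cmod (diff2 (\<lambda>i j. m i j \<xi>) 0 n2))) \<le> ereal B"
    and 0: "(SUP \<xi>. ereal (cmod (m 0 0 \<xi>))) \<le> ereal B"
    and N: "2 \<le> N1" "2 \<le> N2" and f: "f \<in> L2"
  have pt: "(\<Sum>j1<n1. \<Sum>j2<n2. cmod (full_diff (\<lambda>i j. m i j \<xi>) j1 j2)) \<le> 4 * B" for \<xi> n1 n2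
  proof (rule sum_norm_full_diff_le)
    show "cmod (m 0 0 \<xi>) \<le> B"
      using order_trans[OF SUP_upper[OF UNIV_I] 0] by simp
  qed (rule order_trans[OF SUP_upper[OF UNIV_I] 12] order_trans[OF SUP_upper[OF UNIV_I] 1]
        order_trans[OF SUP_upper[OF UNIV_I] 2])+
  \<comment> \<open>The empty sum is 0, so \<open>pt\<close> with both ranges empty reads 0 \<le> 4
    * B.\<close>
  have B0: "0 \<le> B" using pt[of 0 0 undefined] by simp
  obtain l1 where l1: "N1 < 2^l1" "real l1 \<le> 2 / ln 2 * ln (real N1)"
    using dyadic_length_le_ln[OF N(1)] by blast
  obtain l2 where l2: "N2 < 2^l2" "real l2 \<le> 2 / ln 2 * ln (real N2)"
    using dyadic_length_le_ln[OF N(2)] by blast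
  define M where "M = (\<lambda>x. SUP n1\<in>{0..<N1}. SUP n2\<in>{0..<N2}.
                        cmod (inv_fourier_L2 (\<lambda>\<xi>. m n1 n2 \<xi> * fourier_L2 f \<xi>) x))"
  have M: "M \<in> L2" "L2_norm M \<le> real l1 * real l2 * (4 * B * L2_norm f)"
    using maximal_multiplier_bound[OF m[rule_format] pt _ l1(1) _ l2(1) f] N by (simp_all add: M_def)
  note M(2)
  \<comment> \<open>Each number of scales contributes 2 / ln 2 and the variation bound contributes
    4; their product is the constant 16 / (ln 2)^2.\<close>
  also have "real l1 * real l2 * (4 * B * L2_norm f) \<le> (2 / ln 2 * ln (real N1)) * (2 / ln 2 * ln (real N2)) * (4 * B * L2_norm f)"
    using B0 N by (intro mult_right_mono mult_mono l1(2) l2(2)) auto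
  also have "\<dots> = 16 / (ln 2)\<^sup>2 * B * ln (real N1) * ln (real N2) * L2_norm f"
    by (simp add: power2_eq_square)
  finally show "let M = (\<lambda>x. SUP n1\<in>{0..<N1}. SUP n2\<in>{0..<N2}.
                        cmod (inv_fourier_L2 (\<lambda>\<xi>. m n1 n2 \<xi> * fourier_L2 f \<xi>) x))
         in M \<in> L2 \<and> L2_norm M \<le> 16 / (ln 2)\<^sup>2 * B * ln (real N1) * ln (real N2) * L2_norm f"
    using M(1) unfolding M_def Let_def by blast
qed simp

end
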